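(* Let $\mathbf{T}=\{(z,w)\in\mathbf{C}^2 : |z|<|w|<1\}$ be the Hartogs triangle. There exists a constant $C>0$ such that $$\|f\|^2\le C\,\|df\|^2$$ for all $f\in W^1(\mathbf{T})$ with $(f,1)=0$.
   Context: $W^1(\mathbf{T})$ is the Sobolev space of $L^2$ functions on $\mathbf{T}$ with weak first-order derivatives in $L^2$; $\|\cdot\|$ and $(\cdot,\cdot)$ denote the $L^2$ norm and $L^2$ inner product on $\mathbf{T}$ (for functions and for forms); $df$ is the weak (full real) differential of $f$. The condition $(f,1)=0$ says that $f$ has mean zero on $\mathbf{T}$. *)

theory Defs
  imports "HOL-Analysis.Analysis"
begin

definition hartogs_triangle :: "(complex \<times> complex) set" where
  "hartogs_triangle = {(z, w). norm z < norm w \<and> norm w < 1}"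

section \<open>Test functions\<close>

primrec C_times_diff :: "nat \<Rightarrow> ('a::euclidean_space \<Rightarrow> real) \<Rightarrow> bool" where
  "C_times_diff 0 \<phi> \<longleftrightarrow> continuous_on UNIV \<phi>"
| "C_times_diff (Suc k) \<phi> \<longleftrightarrow> (\<forall>x. \<phi> differentiable (at x)) \<and>
     (\<forall>b\<in>Basis. C_times_diff k (\<lambda>x. frechet_derivative \<phi> (at x) b))"

definition test_functions :: "'a::euclidean_space set \<Rightarrow> ('a \<Rightarrow> real) set" where
  "test_functions U = {\<phi>. (\<forall>k. C_times_diff k \<phi>) \<and>
     (\<exists>K. compact K \<and> K \<subseteq> U \<and> (\<forall>x. x \<notin> K \<longrightarrow> \<phi> x = 0))}"

section \<open>Square integrable functions and one-forms\<close>

text \<open>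
  Functions are representatives of their almost-everywhere classes, and only their values
  on \<open>U\<close> matter. A complex-valued one-form is a map into the real-linear functionals; its
  pointwise norm comes from the Euclidean metric, for which \<open>Basis\<close> is orthonormal, so that
  on \<open>\<complex>\<^sup>2\<close> it involves all four real directions.
\<close>

definition L2_on :: "'a::euclidean_space set \<Rightarrow> ('a \<Rightarrow> complex) \<Rightarrow> bool" where
  "L2_on U f \<longleftrightarrow> f \<in> borel_measurable (lebesgue_on U) \<and>
     integrable (lebesgue_on U) (\<lambda>x. (norm (f x))\<^sup>2)"

definition L2_inner :: "'a::euclidean_space set \<Rightarrow> ('a \<Rightarrow> complex) \<Rightarrow> ('a \<Rightarrow> complex) \<Rightarrow> complex"
  where "L2_inner U f g = (LINT x|lebesgue_on U. f x * cnj (g x))"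

definition L2_norm :: "'a::euclidean_space set \<Rightarrow> ('a \<Rightarrow> complex) \<Rightarrow> real" where
  "L2_norm U f = sqrt (LINT x|lebesgue_on U. (norm (f x))\<^sup>2)"

definition L2_form_on :: "'a::euclidean_space set \<Rightarrow> ('a \<Rightarrow> 'a \<Rightarrow>\<^sub>L complex) \<Rightarrow> bool" where
  "L2_form_on U \<omega> \<longleftrightarrow> (\<forall>b\<in>Basis. L2_on U (\<lambda>x. blinfun_apply (\<omega> x) b))"

definition L2_form_norm :: "'a::euclidean_space set \<Rightarrow> ('a \<Rightarrow> 'a \<Rightarrow>\<^sub>L complex) \<Rightarrow> real" where
  "L2_form_norm U \<omega> =
     sqrt (LINT x|lebesgue_on U. (\<Sum>b\<in>Basis. (norm (blinfun_apply (\<omega> x) b))\<^sup>2))"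

section \<open>Weak differential and the Sobolev space\<close>

definition locally_integrable_on :: "('a::euclidean_space \<Rightarrow> complex) \<Rightarrow> 'a set \<Rightarrow> bool" where
  "locally_integrable_on f U \<longleftrightarrow>
     (\<forall>K. compact K \<and> K \<subseteq> U \<longrightarrow> integrable (lebesgue_on K) f)"

definition has_weak_differential ::
  "'a::euclidean_space set \<Rightarrow> ('a \<Rightarrow> complex) \<Rightarrow> ('a \<Rightarrow> 'a \<Rightarrow>\<^sub>L complex) \<Rightarrow> bool" where
  "has_weak_differential U f \<omega> \<longleftrightarrow>
     locally_integrable_on f U \<and>
     (\<forall>b\<in>Basis. locally_integrable_on (\<lambda>x. blinfun_apply (\<omega> x) b) U \<and>
       (\<forall>\<phi>\<in>test_functions U.
          (LINT x|lebesgue_on U. frechet_derivative \<phi> (at x) b *\<^sub>R f x) =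
          - (LINT x|lebesgue_on U. \<phi> x *\<^sub>R blinfun_apply (\<omega> x) b)))"

definition Sobolev_W1 :: "'a::euclidean_space set \<Rightarrow> ('a \<Rightarrow> complex) set" where
  "Sobolev_W1 U = {f. L2_on U f \<and> (\<exists>\<omega>. has_weak_differential U f \<omega> \<and> L2_form_on U \<omega>)}"

text \<open>
  On an open set a weak differential is unique up to a null set, so the choice does not
  affect its norm. The definition is meaningful for \<open>f \<in> Sobolev_W1 U\<close> only.
\<close>

definition weak_differential ::
  "'a::euclidean_space set \<Rightarrow> ('a \<Rightarrow> complex) \<Rightarrow> 'a \<Rightarrow> 'a \<Rightarrow>\<^sub>L complex" where
  "weak_differential U f = (SOME \<omega>. has_weak_differential U f \<omega> \<and> L2_form_on U \<omega>)"

end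

theory Submission
  imports Defs
begin

text \<open>
  The boundary of the Hartogs triangle is not Lipschitz at the origin, so the standard compactness
  argument for Lipschitz domains does not apply. The inequality can be shown directly, because
  every point of the domain sees a large part of it along straight segments.
  
  Let \<open>F\<close> have the weak gradient \<open>W\<close> on an open set \<open>U\<close>. If the segments from \<open>x\<close> to \<open>x + h\<close> lie in
  \<open>U\<close> for all \<open>x\<close> in an open set, then \<open>F (x + h) - F x\<close> is, for almost all these \<open>x\<close>, the integral
  of \<open>W\<close> along the segment (\<open>difference_eq_segment_integral\<close>). This follows by testing with smooth
  bumps and translating the bump instead of the function. Cauchy-Schwarz and the translation
  invariance of Lebesgue measure bound the \<open>L\<^sup>2\<close> norm of the increment by \<open>norm h\<close> times the \<open>L\<^sup>2\<close>
  norm of \<open>W\<close> (\<open>difference_L2_bound\<close>), and an integration over \<open>h\<close> bounds the integral of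
  \<open>(norm (F x - F y))\<^sup>2\<close> over all pairs of points \<open>x \<in> S\<close>, \<open>y \<in> B\<close>, provided that \<open>S\<close> and \<open>B\<close> see
  each other in \<open>U\<close> (\<open>visible_pairs_bound\<close>). Choosing a good \<open>y \<in> B\<close> gives a Poincare inequality on
  \<open>S\<close> with the constant \<open>F y\<close> in place of the mean value (\<open>poincare_on_visible\<close>). Such inequalities
  pass to unions of overlapping bounded open sets (\<open>poincare_on_Un\<close>).
  
  The Hartogs triangle is the union of four overlapping sectors, in each of which the argument
  of \<open>w\<close> is near that of \<open>1\<close>, \<open>\<i>\<close>, \<open>-1\<close> or \<open>-\<i>\<close>. A sector with direction \<open>e\<close> sees a
  whole ball around \<open>(0, e / 2)\<close>: on the way to this ball the first coordinate tends to zero, while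
  the second one keeps a component along \<open>w\<close> (\<open>sector_sees_ball\<close>). This gives the inequality
  on the Hartogs triangle with some constant subtracted from \<open>F\<close>; for a function of mean zero,
  subtracting nothing is at least as good (\<open>mean_zero_minimizes\<close>).
\<close>

section \<open>Smooth bump functions on boxes\<close>

text \<open>
  This is the classical flat function \<open>exp (- 1 / t)\<close> together with its multiples by powers of
  \<open>1 / t\<close>. The whole family is needed because the span of its members is closed under
  differentiation, which makes smoothness a plain induction on the order of the derivative.
\<close>

definition flat :: "nat \<Rightarrow> real \<Rightarrow> real" where
  "flat m t = (if t \<le> 0 then 0 else inverse t ^ m * exp (- inverse t))"

lemma flat_tendsto_0: "(flat m \<longlongrightarrow> 0) (at_right 0)"
proof -
  have "((\<lambda>s::real. s ^ m / exp s) \<longlongrightarrow> 0) at_top"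
    by (rule tendsto_power_div_exp_0)
  from filterlim_compose[OF this filterlim_inverse_at_top_right]
  have "((\<lambda>t::real. inverse t ^ m / exp (inverse t)) \<longlongrightarrow> 0) (at_right 0)" .
  then show ?thesis
    by (rule Lim_transform_eventually)
       (auto simp: flat_def exp_minus field_simps eventually_at_right_less eventually_at_filter)
qed

lemma flat_has_derivative:
  "(flat m has_real_derivative flat (m + 2) t - real m * flat (m + 1) t) (at t)"
proof -
  consider "t < 0" | "t > 0" | "t = 0" by linarith
  then show ?thesis
  proof cases
    case 1
    have "((\<lambda>_. 0) has_real_derivative flat (m + 2) t - real m * flat (m + 1) t) (at t)"
      using 1 by (simp add: flat_def)
    then show ?thesis
      by (rule has_field_derivative_transform_within_open[where S = "{..<0}"])
         (use 1 in \<open>auto simp: flat_def\<close>)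
  next
    case 2
    have "((\<lambda>t. inverse t ^ m * exp (- inverse t)) has_real_derivative
        flat (m + 2) t - real m * flat (m + 1) t) (at t)"
      using 2 by (auto intro!: derivative_eq_intros simp: flat_def power2_eq_square)
        (cases m; simp add: field_simps power2_eq_square)
    then show ?thesis
      by (rule has_field_derivative_transform_within_open[where S = "{0<..}"])
         (use 2 in \<open>auto simp: flat_def\<close>)
  next
    case 3
    have "((\<lambda>y. (flat m y - flat m 0) / (y - 0)) \<longlongrightarrow> 0) (at_left 0)"
      by (rule Lim_transform_eventually[OF tendsto_const])
         (auto simp: flat_def eventually_at_filter)
    moreover have "((\<lambda>y. (flat m y - flat m 0) / (y - 0)) \<longlongrightarrow> 0) (at_right 0)"
      by (rule Lim_transform_eventually[OF flat_tendsto_0[of "m + 1"]])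
         (auto simp: flat_def eventually_at_filter field_simps)
    ultimately show ?thesis
      using 3 by (simp add: has_field_derivative_iff filterlim_split_at flat_def)
  qed
qed

lemma frechet_derivative_eqI:
  "(f has_derivative f') (at x) \<Longrightarrow> frechet_derivative f (at x) = f'"
  by (metis frechet_derivative_at)

lemma C_times_diff_Suc_imp: "C_times_diff (Suc k) \<phi> \<Longrightarrow> C_times_diff k \<phi>"
proof (induction k arbitrary: \<phi>)
  case 0
  then show ?case
    by (auto simp: continuous_on_eq_continuous_within intro!: differentiable_imp_continuous_within)
next
  case (Suc k)
  then show ?case by auto
qed

lemma C_times_diff_const: "C_times_diff k (\<lambda>x::'a::euclidean_space. c)"
proof (induction k arbitrary: c)
  case (Suc k)
  then show ?case by (simp add: frechet_derivative_const)
qed auto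

lemma C_times_diff_add:
  fixes \<phi> \<psi> :: "'a::euclidean_space \<Rightarrow> real"
  shows "C_times_diff k \<phi> \<Longrightarrow> C_times_diff k \<psi> \<Longrightarrow> C_times_diff k (\<lambda>x. \<phi> x + \<psi> x)"
proof (induction k arbitrary: \<phi> \<psi>)
  case 0
  then show ?case by (auto intro: continuous_intros)
next
  case (Suc k)
  have *: "frechet_derivative (\<lambda>x. \<phi> x + \<psi> x) (at x) =
      (\<lambda>b. frechet_derivative \<phi> (at x) b + frechet_derivative \<psi> (at x) b)" for x
    using Suc.prems by (intro frechet_derivative_eqI has_derivative_add)
      (auto simp: frechet_derivative_works[symmetric])
  show ?case using Suc by (auto simp: *)
qed

lemma C_times_diff_mult:
  fixes \<phi> \<psi> :: "'a::euclidean_space \<Rightarrow> real"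
  shows "C_times_diff k \<phi> \<Longrightarrow> C_times_diff k \<psi> \<Longrightarrow> C_times_diff k (\<lambda>x. \<phi> x * \<psi> x)"
proof (induction k arbitrary: \<phi> \<psi>)
  case 0
  then show ?case by (auto intro: continuous_intros)
next
  case (Suc k)
  have *: "frechet_derivative (\<lambda>x. \<phi> x * \<psi> x) (at x) =
      (\<lambda>b. \<phi> x * frechet_derivative \<psi> (at x) b + frechet_derivative \<phi> (at x) b * \<psi> x)" for x
    using Suc.prems by (intro frechet_derivative_eqI has_derivative_mult)
      (auto simp: frechet_derivative_works[symmetric])
  have "C_times_diff k \<phi>" "C_times_diff k \<psi>"
    using Suc.prems by (auto intro: C_times_diff_Suc_imp simp del: C_times_diff.simps)
  with Suc show ?case by (auto simp: * intro!: C_times_diff_add)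
qed

lemma C_times_diff_prod:
  fixes \<phi> :: "'i \<Rightarrow> 'a::euclidean_space \<Rightarrow> real"
  assumes "\<And>i. i \<in> I \<Longrightarrow> C_times_diff k (\<phi> i)"
  shows "C_times_diff k (\<lambda>x. \<Prod>i\<in>I. \<phi> i x)"
  using assms by (induction I rule: infinite_finite_induct)
    (auto intro: C_times_diff_const C_times_diff_mult)

lemma C_times_diff_translate:
  fixes \<phi> :: "'a::euclidean_space \<Rightarrow> real"
  shows "C_times_diff k \<phi> \<Longrightarrow> C_times_diff k (\<lambda>x. \<phi> (x - c))"
proof (induction k arbitrary: \<phi>)
  case 0
  then show ?case
    by (auto intro!: continuous_on_compose2[of UNIV \<phi>] continuous_intros)
next
  case (Suc k)
  have d: "((\<lambda>x. \<phi> (x - c)) has_derivative frechet_derivative \<phi> (at (x - c))) (at x)" for x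
    using Suc.prems
    by (auto intro!: has_derivative_compose[where f = "\<lambda>x. x - c" and g = \<phi>, simplified] derivative_eq_intros
        simp: frechet_derivative_works[symmetric])
  show ?case
    using Suc by (auto simp: frechet_derivative_eqI[OF d] intro!: differentiableI[OF d])
qed

text \<open>
  The induction on the order works for all \<open>m\<close> at once: each derivative is a constant
  multiple of a combination of \<open>flat (m + 1)\<close> and \<open>flat (m + 2)\<close> with the same inner argument.
\<close>

lemma C_times_diff_flat:
  fixes v :: "'a::euclidean_space"
  shows "C_times_diff k (\<lambda>x. flat m (x \<bullet> v + c))"
proof (induction k arbitrary: m)
  case 0
  have "continuous_on UNIV (flat m)"
    using flat_has_derivative by (intro continuous_at_imp_continuous_on) (blast intro: DERIV_isCont)
  then show ?case
    by (auto intro!: continuous_on_compose2[of UNIV "flat m"] continuous_intros)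
next
  case (Suc k)
  have d: "((\<lambda>x. flat m (x \<bullet> v + c)) has_derivative
      (\<lambda>h. (h \<bullet> v) * (flat (m + 2) (x \<bullet> v + c) + (- real m) * flat (m + 1) (x \<bullet> v + c)))) (at x)" for x
    by (rule has_derivative_eq_rhs[OF has_derivative_compose[OF _ 
          flat_has_derivative[unfolded has_field_derivative_def]]])
       (auto intro!: derivative_eq_intros simp: algebra_simps)
  show ?case
    unfolding C_times_diff.simps frechet_derivative_eqI[OF d]
    by (intro conjI allI ballI differentiableI[OF d] C_times_diff_mult C_times_diff_add
        C_times_diff_const Suc)
qed

text \<open>
  As \<open>n\<close> grows, every factor \<open>exp (- 1 / (n s))\<close> with \<open>s > 0\<close> tends to \<open>1\<close>, so these bumps
  approximate the indicator of an open box from inside. The arguments are written in the form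
  \<open>x \<bullet> v + c\<close> to make each factor an instance of \<open>C_times_diff_flat\<close>.
\<close>

definition box_bump :: "nat \<Rightarrow> 'a::euclidean_space \<Rightarrow> 'a \<Rightarrow> 'a \<Rightarrow> real" where
  "box_bump n a b x =
    (\<Prod>i\<in>Basis. flat 0 (x \<bullet> (real n *\<^sub>R i) + (- real n * (a \<bullet> i))) *
                flat 0 (x \<bullet> (- real n *\<^sub>R i) + real n * (b \<bullet> i)))"

lemma C_times_diff_box_bump: "C_times_diff k (box_bump n a b)"
  unfolding box_bump_def[abs_def]
  by (intro C_times_diff_prod C_times_diff_mult C_times_diff_flat)

lemma flat_le_1: "0 \<le> flat 0 t" "flat 0 t \<le> 1"
  by (auto simp: flat_def)

lemma box_bump_bounds: "0 \<le> box_bump n a b x" "box_bump n a b x \<le> 1"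
  unfolding box_bump_def
  by (auto intro!: prod_nonneg prod_le_1 mult_le_one flat_le_1 mult_nonneg_nonneg)

lemma box_bump_eq_0:
  assumes "x \<notin> box a b" shows "box_bump n a b x = 0"
proof -
  obtain i where i: "i \<in> Basis" "x \<bullet> i \<le> a \<bullet> i \<or> b \<bullet> i \<le> x \<bullet> i"
    using assms by (force simp: box_def not_less)
  then have "real n * (x \<bullet> i) \<le> real n * (a \<bullet> i) \<or> real n * (b \<bullet> i) \<le> real n * (x \<bullet> i)"
    by (auto intro: mult_left_mono)
  then show ?thesis
    unfolding box_bump_def using i(1)
    by (intro prod_zero[OF finite_Basis] bexI[of _ i]) (auto simp: flat_def)
qed

lemma flat_scaled_tendsto_1:
  assumes "t > 0" shows "(\<lambda>n. flat 0 (real n * t)) \<longlonglongrightarrow> 1"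
proof -
  have "(\<lambda>n. exp (- (inverse (real n) * inverse t))) \<longlonglongrightarrow> exp (- (0 * inverse t))"
    by (intro tendsto_intros lim_inverse_n)
  then have "(\<lambda>n. exp (- (inverse (real n) * inverse t))) \<longlonglongrightarrow> 1" by simp
  then show ?thesis
    by (rule Lim_transform_eventually)
       (use assms in \<open>auto intro!: eventually_sequentiallyI[of 1] simp: flat_def not_le mult_le_0_iff\<close>)
qed

lemma box_bump_tendsto: "(\<lambda>n. box_bump n a b x) \<longlonglongrightarrow> indicator (box a b) x"
proof (cases "x \<in> box a b")
  case True
  have "(\<lambda>n. box_bump n a b x) \<longlonglongrightarrow> (\<Prod>i\<in>(Basis::'a set). 1 * 1)"
    unfolding box_bump_def
  proof (intro tendsto_prod tendsto_mult)
    fix i :: 'a assume "i \<in> Basis"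
    then have "0 < x \<bullet> i - a \<bullet> i" "0 < b \<bullet> i - x \<bullet> i"
      using True by (auto simp: box_def)
    from this[THEN flat_scaled_tendsto_1]
    show "(\<lambda>n. flat 0 (x \<bullet> (real n *\<^sub>R i) + (- real n * (a \<bullet> i)))) \<longlonglongrightarrow> 1"
      "(\<lambda>n. flat 0 (x \<bullet> (- real n *\<^sub>R i) + real n * (b \<bullet> i))) \<longlonglongrightarrow> 1"
      by (simp_all add: algebra_simps)
  qed
  with True show ?thesis by simp
qed (simp add: box_bump_eq_0)

lemma box_bump_test_function:
  assumes "\<And>x. x \<in> cbox a b \<Longrightarrow> x + c \<in> U"
  shows "(\<lambda>x. box_bump n a b (x - c)) \<in> test_functions U"
  unfolding test_functions_def
proof (intro CollectI conjI allI exI[of _ "(\<lambda>x. x + c) ` cbox a b"])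
  show "C_times_diff k (\<lambda>x. box_bump n a b (x - c))" for k
    by (intro C_times_diff_translate C_times_diff_box_bump)
  show "compact ((\<lambda>x. x + c) ` cbox a b)"
    by (intro compact_continuous_image continuous_intros compact_cbox)
  show "(\<lambda>x. x + c) ` cbox a b \<subseteq> U" using assms by auto
  show "x \<notin> (\<lambda>x. x + c) ` cbox a b \<longrightarrow> box_bump n a b (x - c) = 0" for x
    using box_subset_cbox[of a b] by (intro impI box_bump_eq_0) (force simp: image_iff)
qed


section \<open>Weak derivatives along a segment\<close>

lemma nn_integral_lborel_translate:
  fixes g :: "'a::euclidean_space \<Rightarrow> ennreal"
  assumes [measurable]: "g \<in> borel_measurable borel"
  shows "(\<integral>\<^sup>+x. g (x + c) \<partial>lborel) = (\<integral>\<^sup>+x. g x \<partial>lborel)"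
proof -
  have "(\<integral>\<^sup>+x. g x \<partial>lborel) = (\<integral>\<^sup>+x. g x \<partial>distr lborel borel ((+) c))"
    by (simp add: lborel_distr_plus)
  also have "\<dots> = (\<integral>\<^sup>+x. g (x + c) \<partial>lborel)"
    by (subst nn_integral_distr) (simp_all add: add.commute)
  finally show ?thesis ..
qed

lemma lborel_translate:
  fixes g :: "'a::euclidean_space \<Rightarrow> 'b::{banach, second_countable_topology}"
  assumes [measurable]: "g \<in> borel_measurable borel"
  shows integral_lborel_translate: "(LINT x|lborel. g (x + c)) = (LINT x|lborel. g x)" (is ?I)
    and integrable_lborel_translate: "integrable lborel (\<lambda>x. g (x + c)) \<longleftrightarrow> integrable lborel g" (is ?J)
proof -
  have "(LINT x|lborel. g x) = (LINT x|distr lborel borel ((+) c). g x)"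
    by (simp add: lborel_distr_plus)
  also have "\<dots> = (LINT x|lborel. g (x + c))"
    by (subst integral_distr) (simp_all add: add.commute)
  finally show ?I ..
  have "integrable lborel g \<longleftrightarrow> integrable (distr lborel borel ((+) c)) g"
    by (simp add: lborel_distr_plus)
  also have "\<dots> \<longleftrightarrow> integrable lborel (\<lambda>x. g (x + c))"
    by (subst integrable_distr_eq) (simp_all add: add.commute)
  finally show ?J ..
qed

text \<open>
  This is the integrability that every exchange of the integral over a domain with the integral
  along a segment relies on; translation invariance makes the inner norm independent of \<open>t\<close>.
\<close>

lemma integrable_pair_translates:
  fixes g :: "'a::euclidean_space \<Rightarrow> complex"
  assumes g: "integrable lborel g"
  shows "integrable (lborel \<Otimes>\<^sub>M lborel) (\<lambda>(t, x). indicator {0..1::real} t *\<^sub>R g (x + t *\<^sub>R h))"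
proof (rule lborel_pair.Fubini_integrable)
  have [measurable]: "g \<in> borel_measurable borel"
    using borel_measurable_integrable[OF g] by simp
  show "(\<lambda>(t, x). indicator {0..1::real} t *\<^sub>R g (x + t *\<^sub>R h))
      \<in> borel_measurable (lborel \<Otimes>\<^sub>M lborel)"
    by measurable
  have "(\<integral>x. norm (indicator {0..1::real} t *\<^sub>R g (x + t *\<^sub>R h)) \<partial>lborel)
      = indicator {0..1} t * (\<integral>x. norm (g x) \<partial>lborel)" for t
    using integral_lborel_translate[of "\<lambda>x. norm (g x)" "t *\<^sub>R h"] by simp
  then show "integrable lborel (\<lambda>t. \<integral>x. norm (case (t, x) of (t, x) \<Rightarrow>
      indicator {0..1::real} t *\<^sub>R g (x + t *\<^sub>R h)) \<partial>lborel)"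
    by (simp only: prod.case) simp
  show "AE t in lborel. integrable lborel (\<lambda>x. case (t, x) of (t, x) \<Rightarrow>
      indicator {0..1::real} t *\<^sub>R g (x + t *\<^sub>R h))"
    using g by (auto simp: integrable_lborel_translate)
qed

text \<open>
  Test functions and their derivatives are continuous, bounded multipliers, so their
  products with integrable functions are integrable.
\<close>

lemma test_function_continuous:
  assumes "\<phi> \<in> test_functions U"
  shows "continuous_on UNIV \<phi>"
  using assms unfolding test_functions_def by (metis (no_types, lifting) C_times_diff.simps(1) mem_Collect_eq)

lemma test_function_derivative:
  assumes "\<phi> \<in> test_functions U"
  shows "(\<phi> has_derivative frechet_derivative \<phi> (at x)) (at x)"
proof -
  have "C_times_diff (Suc 0) \<phi>"
    using assms unfolding test_functions_def by blast
  then show ?thesis by (simp add: frechet_derivative_works[symmetric])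
qed

lemma test_function_derivative_expand:
  fixes \<phi> :: "'a::euclidean_space \<Rightarrow> real"
  assumes "\<phi> \<in> test_functions U"
  shows "frechet_derivative \<phi> (at x) h = (\<Sum>b\<in>Basis. (h \<bullet> b) * frechet_derivative \<phi> (at x) b)"
proof -
  have "linear (frechet_derivative \<phi> (at x))"
    using test_function_derivative[OF assms] by (rule has_derivative_linear)
  from linear_sum[OF this, of "\<lambda>b. (h \<bullet> b) *\<^sub>R b" Basis] linear_scale[OF this]
  show ?thesis by (simp add: euclidean_representation)
qed

lemma test_function_derivative_continuous:
  fixes \<phi> :: "'a::euclidean_space \<Rightarrow> real"
  assumes "\<phi> \<in> test_functions U"
  shows "continuous_on UNIV (\<lambda>x. frechet_derivative \<phi> (at x) h)"
proof -
  have "C_times_diff (Suc 0) \<phi>"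
    using assms unfolding test_functions_def by blast
  then show ?thesis
    by (subst test_function_derivative_expand[OF assms]) (auto intro!: continuous_intros)
qed

lemma bounded_if_compact_support:
  fixes g :: "'a::euclidean_space \<Rightarrow> real"
  assumes "continuous_on UNIV g" "compact K" "\<And>x. x \<notin> K \<Longrightarrow> g x = 0"
  obtains M where "\<And>x. \<bar>g x\<bar> \<le> M"
proof -
  have "bounded (g ` K)"
    using assms by (intro compact_imp_bounded compact_continuous_image) (auto intro: continuous_on_subset)
  then obtain M where "\<And>x. x \<in> K \<Longrightarrow> \<bar>g x\<bar> \<le> M"
    by (auto simp: bounded_iff)
  then have "\<bar>g x\<bar> \<le> max M 0" for x
    using assms(3)[of x] by (cases "x \<in> K") (auto simp: le_max_iff_disj)
  then show ?thesis by (rule that)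
qed

lemma test_function_bounded:
  fixes \<phi> :: "'a::euclidean_space \<Rightarrow> real"
  assumes "\<phi> \<in> test_functions U"
  obtains M where "\<And>x. \<bar>\<phi> x\<bar> \<le> M"
  using bounded_if_compact_support[OF test_function_continuous[OF assms]] assms
  unfolding test_functions_def by blast

lemma test_function_derivative_bounded:
  fixes \<phi> :: "'a::euclidean_space \<Rightarrow> real"
  assumes \<phi>: "\<phi> \<in> test_functions U"
  obtains M where "\<And>x. \<bar>frechet_derivative \<phi> (at x) h\<bar> \<le> M"
proof -
  obtain K where K: "compact K" "\<And>x. x \<notin> K \<Longrightarrow> \<phi> x = 0"
    using \<phi> unfolding test_functions_def by blast
  have "frechet_derivative \<phi> (at x) h = 0" if "x \<notin> K" for x
  proof -
    have "(\<phi> has_derivative (\<lambda>_. 0)) (at x)"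
      by (rule has_derivative_transform_within_open[of "\<lambda>_. 0" "\<lambda>_. 0" x UNIV "- K"])
         (use K that compact_imp_closed in \<open>auto simp: open_Compl\<close>)
    from frechet_derivative_eqI[OF this] show ?thesis by simp
  qed
  then show ?thesis
    using bounded_if_compact_support[OF test_function_derivative_continuous[OF \<phi>] K(1)] that by blast
qed

lemma integrable_bounded_scaleR:
  fixes F :: "'a::euclidean_space \<Rightarrow> complex" and g :: "'a \<Rightarrow> real"
  assumes F: "integrable lborel F" and g: "continuous_on UNIV g" and M: "\<And>x. \<bar>g x\<bar> \<le> M"
  shows "integrable lborel (\<lambda>x. g x *\<^sub>R F x)"
proof (rule Bochner_Integration.integrable_bound)
  show "integrable lborel (\<lambda>x. M * norm (F x))" using F by simp
  have [measurable]: "g \<in> borel_measurable borel"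
    using g by (simp add: borel_measurable_continuous_onI)
  show "(\<lambda>x. g x *\<^sub>R F x) \<in> borel_measurable lborel"
    using borel_measurable_integrable[OF F] by simp
  have "0 \<le> M" using M[of 0] by linarith
  then show "AE x in lborel. norm (g x *\<^sub>R F x) \<le> norm (M * norm (F x))"
    using M by (auto intro!: mult_right_mono)
qed

text \<open>
  A weak gradient for Borel functions that are integrable over the whole space. Working with Borel
  functions matters: \<open>(t, x) \<mapsto> F (x + t *\<^sub>R h)\<close> is then jointly measurable, which can fail for
  a function that is only Lebesgue measurable.
\<close>

definition L1_weak_gradient ::
  "'a::euclidean_space set \<Rightarrow> ('a \<Rightarrow> complex) \<Rightarrow> ('a \<Rightarrow> 'a \<Rightarrow> complex) \<Rightarrow> bool" where
  "L1_weak_gradient U F W \<longleftrightarrow> integrable lborel F \<and>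
     (\<forall>b\<in>Basis. integrable lborel (W b) \<and>
        (\<forall>\<phi>\<in>test_functions U.
          (LINT x|lborel. frechet_derivative \<phi> (at x) b *\<^sub>R F x) = - (LINT x|lborel. \<phi> x *\<^sub>R W b x)))"

definition directional :: "('a::euclidean_space \<Rightarrow> 'a \<Rightarrow> complex) \<Rightarrow> 'a \<Rightarrow> 'a \<Rightarrow> complex" where
  "directional W h x = (\<Sum>b\<in>Basis. (h \<bullet> b) *\<^sub>R W b x)"

lemma directional_integrable:
  "L1_weak_gradient U F W \<Longrightarrow> integrable lborel (directional W h)"
  unfolding L1_weak_gradient_def directional_def[abs_def] by auto

lemma weak_directional_derivative:
  assumes W: "L1_weak_gradient U F W" and \<phi>: "\<phi> \<in> test_functions U"
  shows "(LINT x|lborel. frechet_derivative \<phi> (at x) h *\<^sub>R F x)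
       = - (LINT x|lborel. \<phi> x *\<^sub>R directional W h x)"
proof -
  have F: "integrable lborel F" using W by (simp add: L1_weak_gradient_def)
  have i1: "integrable lborel (\<lambda>x. frechet_derivative \<phi> (at x) b *\<^sub>R F x)" for b
  proof -
    obtain M where "\<And>x. \<bar>frechet_derivative \<phi> (at x) b\<bar> \<le> M"
      using test_function_derivative_bounded[OF \<phi>] by blast
    with F test_function_derivative_continuous[OF \<phi>] show ?thesis
      by (rule integrable_bounded_scaleR)
  qed
  have i2: "integrable lborel (\<lambda>x. \<phi> x *\<^sub>R W b x)" if "b \<in> Basis" for b
  proof -
    obtain M where "\<And>x. \<bar>\<phi> x\<bar> \<le> M"
      using test_function_bounded[OF \<phi>] by blast
    with _ test_function_continuous[OF \<phi>] show ?thesis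
      by (rule integrable_bounded_scaleR) (use W that in \<open>auto simp: L1_weak_gradient_def\<close>)
  qed
  have "(LINT x|lborel. frechet_derivative \<phi> (at x) h *\<^sub>R F x)
      = (LINT x|lborel. (\<Sum>b\<in>Basis. (h \<bullet> b) *\<^sub>R (frechet_derivative \<phi> (at x) b *\<^sub>R F x)))"
    by (subst test_function_derivative_expand[OF \<phi>]) (simp add: scaleR_sum_left)
  also have "\<dots> = (\<Sum>b\<in>Basis. (h \<bullet> b) *\<^sub>R (LINT x|lborel. frechet_derivative \<phi> (at x) b *\<^sub>R F x))"
    using i1 by (simp add: Bochner_Integration.integral_sum del: scaleR_scaleR)
  also have "\<dots> = (\<Sum>b\<in>Basis. - ((h \<bullet> b) *\<^sub>R (LINT x|lborel. \<phi> x *\<^sub>R W b x)))"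
    using W \<phi> by (intro sum.cong) (auto simp: L1_weak_gradient_def)
  also have "\<dots> = - (LINT x|lborel. (\<Sum>b\<in>Basis. (h \<bullet> b) *\<^sub>R (\<phi> x *\<^sub>R W b x)))"
    using i2 by (simp add: Bochner_Integration.integral_sum sum_negf del: scaleR_scaleR)
  also have "\<dots> = - (LINT x|lborel. \<phi> x *\<^sub>R directional W h x)"
    by (simp add: directional_def scaleR_sum_right mult.commute)
  finally show ?thesis .
qed

text \<open>
  A shift of the test function is an integral of its directional derivatives. This moves the
  difference quotient away from the weakly differentiable function, for which no fundamental theorem
  of calculus is available.
\<close>

lemma test_function_FTC:
  fixes \<phi> :: "'a::euclidean_space \<Rightarrow> real"
  assumes \<phi>: "\<phi> \<in> test_functions U"
  shows "has_bochner_integral lborel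
    (\<lambda>t. indicator {0..1::real} t *\<^sub>R frechet_derivative \<phi> (at (y - t *\<^sub>R h)) h) (\<phi> y - \<phi> (y - h))"
proof -
  have d: "((\<lambda>t. - \<phi> (y - t *\<^sub>R h)) has_vector_derivative
      frechet_derivative \<phi> (at (y - t *\<^sub>R h)) h) (at t within {0..1})" for t
  proof -
    have "((\<lambda>t. - \<phi> (y - t *\<^sub>R h)) has_derivative
        (\<lambda>s. - frechet_derivative \<phi> (at (y - t *\<^sub>R h)) (- (s *\<^sub>R h)))) (at t within {0..1})"
      by (rule has_derivative_minus, rule has_derivative_compose[OF _ test_function_derivative[OF \<phi>]])
         (auto intro!: derivative_eq_intros)
    moreover have "- frechet_derivative \<phi> (at z) (- (s *\<^sub>R h)) = s *\<^sub>R frechet_derivative \<phi> (at z) h" for s z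
      using test_function_derivative[OF \<phi>, THEN has_derivative_linear]
      by (simp add: linear_neg linear_scale)
    ultimately show ?thesis by (simp add: has_vector_derivative_def)
  qed
  have c: "continuous_on {0..1} (\<lambda>t. frechet_derivative \<phi> (at (y - t *\<^sub>R h)) h)"
    by (rule continuous_on_compose2[OF test_function_derivative_continuous[OF \<phi>]])
       (auto intro!: continuous_intros)
  show ?thesis
    using has_bochner_integral_FTC_Icc[of 0 1, OF _ d c] by simp
qed

definition segment_integral :: "('a::euclidean_space \<Rightarrow> 'a \<Rightarrow> complex) \<Rightarrow> 'a \<Rightarrow> 'a \<Rightarrow> complex" where
  "segment_integral W h x =
    (LINT t|lborel. indicator {0..1::real} t *\<^sub>R directional W h (x + t *\<^sub>R h))"

lemma segment_integral_integrable:
  assumes W: "L1_weak_gradient U F W"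
  shows "integrable lborel (segment_integral W h)"
  unfolding segment_integral_def[abs_def]
  using lborel_pair.integrable_snd[OF integrable_pair_translates[OF directional_integrable[OF W]]] .

lemma integrable_pair_bounded_scaleR:
  fixes F :: "'a::euclidean_space \<times> 'b::euclidean_space \<Rightarrow> complex" and g :: "'a \<times> 'b \<Rightarrow> real"
  assumes F: "integrable (lborel \<Otimes>\<^sub>M lborel) F" and g: "continuous_on UNIV g" and M: "\<And>x. \<bar>g x\<bar> \<le> M"
  shows "integrable (lborel \<Otimes>\<^sub>M lborel) (\<lambda>x. g x *\<^sub>R F x)"
  using integrable_bounded_scaleR[of F g M] assms by (simp add: lborel_prod)

text \<open>
  The difference \<open>F (x + h) - F x\<close> equals \<open>segment_integral W h x\<close> in the sense of distributions.
  A translation of variables moves the shift to \<open>\<phi>\<close>, the fundamental theorem writes the shift of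
  \<open>\<phi>\<close> as an integral over \<open>t\<close>, and for each fixed \<open>t\<close> the definition of the weak gradient applies to
  the translate of \<open>\<phi>\<close> by \<open>t *\<^sub>R h\<close>. This is why all the intermediate translates must be
  supported in \<open>U\<close>. Fubini's theorem exchanges the two integrals before and after that step.
\<close>

lemma weak_difference_identity:
  fixes h :: "'a::euclidean_space"
  assumes W: "L1_weak_gradient U F W"
    and \<phi>: "\<And>t. t \<in> {0..1} \<Longrightarrow> (\<lambda>y. \<phi> (y - t *\<^sub>R h)) \<in> test_functions U"
  shows "(LINT x|lborel. \<phi> x *\<^sub>R (F (x + h) - F x - segment_integral W h x)) = 0"
proof -
  have \<phi>0: "\<phi> \<in> test_functions U" using \<phi>[of 0] by simp
  note c\<phi> = test_function_continuous[OF \<phi>0]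
  obtain M where M: "\<And>x. \<bar>\<phi> x\<bar> \<le> M" using test_function_bounded[OF \<phi>0] by blast
  obtain M' where M': "\<And>x. \<bar>frechet_derivative \<phi> (at x) h\<bar> \<le> M'"
    using test_function_derivative_bounded[OF \<phi>0] by blast
  have F: "integrable lborel F" using W by (simp add: L1_weak_gradient_def)
  have [measurable]: "F \<in> borel_measurable borel" "\<phi> \<in> borel_measurable borel"
    using borel_measurable_integrable[OF F] c\<phi> by (simp_all add: borel_measurable_continuous_onI)
  have Wm [measurable]: "directional W h \<in> borel_measurable borel"
    using borel_measurable_integrable[OF directional_integrable[OF W]] by simp
  have Fh: "integrable lborel (\<lambda>x. F (x + h))"
    using F by (simp add: integrable_lborel_translate)
  have i\<phi>: "integrable lborel (\<lambda>x. \<phi> x *\<^sub>R g x)" if "integrable lborel g" for g :: "'a \<Rightarrow> complex"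
    using that c\<phi> M by (rule integrable_bounded_scaleR)
  have c\<phi>h: "continuous_on UNIV (\<lambda>x. \<phi> (x - h))"
    by (rule continuous_on_compose2[OF c\<phi>]) (auto intro!: continuous_intros)
  have i\<phi>h: "integrable lborel (\<lambda>x. \<phi> (x - h) *\<^sub>R F x)"
    using F c\<phi>h M by (rule integrable_bounded_scaleR)
  let ?D = "\<lambda>t y. frechet_derivative \<phi> (at (y - t *\<^sub>R h)) h"
  let ?I = "indicator {0..1::real} :: real \<Rightarrow> real"
  have dtr: "frechet_derivative (\<lambda>y. \<phi> (y - t *\<^sub>R h)) (at y) h = ?D t y" for t y
  proof -
    have "((\<lambda>y. \<phi> (y - t *\<^sub>R h)) has_derivative frechet_derivative \<phi> (at (y - t *\<^sub>R h))) (at y)"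
      by (rule has_derivative_compose[OF _ test_function_derivative[OF \<phi>0], of "\<lambda>y. y - t *\<^sub>R h", simplified])
         (auto intro!: derivative_eq_intros)
    from frechet_derivative_eqI[OF this] show ?thesis by simp
  qed
  have p1: "integrable (lborel \<Otimes>\<^sub>M lborel) (\<lambda>(t, y). ?I t *\<^sub>R (?D t y *\<^sub>R F y))"
  proof -
    have "continuous_on UNIV (\<lambda>p. ?D (fst p) (snd p))"
      by (rule continuous_on_compose2[OF test_function_derivative_continuous[OF \<phi>0]])
         (auto intro!: continuous_intros)
    from integrable_pair_bounded_scaleR[OF integrable_pair_translates[OF F, of 0] this, of M'] M'
    show ?thesis by (simp add: case_prod_beta' mult.commute)
  qed
  have p2: "integrable (lborel \<Otimes>\<^sub>M lborel) (\<lambda>(t, x). ?I t *\<^sub>R (\<phi> x *\<^sub>R directional W h (x + t *\<^sub>R h)))"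
  proof -
    have "continuous_on UNIV (\<lambda>p::real \<times> 'a. \<phi> (snd p))"
      by (rule continuous_on_compose2[OF c\<phi>]) (auto intro!: continuous_intros)
    from integrable_pair_bounded_scaleR[OF integrable_pair_translates[OF directional_integrable[OF W]] this, of M] M
    show ?thesis by (simp add: case_prod_beta' mult.commute)
  qed
  have shift: "(LINT y|lborel. \<phi> (y - t *\<^sub>R h) *\<^sub>R directional W h y)
      = (LINT x|lborel. \<phi> x *\<^sub>R directional W h (x + t *\<^sub>R h))" for t
    using integral_lborel_translate[of "\<lambda>y. \<phi> (y - t *\<^sub>R h) *\<^sub>R directional W h y" "t *\<^sub>R h"] by simp
  have pull: "(LINT t|lborel. ?I t *\<^sub>R (\<phi> x *\<^sub>R directional W h (x + t *\<^sub>R h)))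
      = \<phi> x *\<^sub>R segment_integral W h x" for x
    unfolding segment_integral_def
    by (rule trans[OF Bochner_Integration.integral_cong integral_scaleR_right]) (simp_all add: mult.commute)
  have "(LINT x|lborel. \<phi> x *\<^sub>R F (x + h)) = (LINT x|lborel. \<phi> (x - h) *\<^sub>R F x)"
    using integral_lborel_translate[of "\<lambda>x. \<phi> (x - h) *\<^sub>R F x" h] by simp
  then have "(LINT x|lborel. \<phi> x *\<^sub>R F x) - (LINT x|lborel. \<phi> x *\<^sub>R F (x + h))
      = (LINT x|lborel. (\<phi> x - \<phi> (x - h)) *\<^sub>R F x)"
    using i\<phi>[OF F] i\<phi>h by (simp add: scaleR_diff_left)
  also have "\<dots> = (LINT y|lborel. (LINT t|lborel. ?I t *\<^sub>R (?D t y *\<^sub>R F y)))"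
  proof (intro Bochner_Integration.integral_cong refl)
    fix y
    from has_bochner_integral_scaleR_left[OF test_function_FTC[OF \<phi>0, of y h], of "F y"]
    show "(\<phi> y - \<phi> (y - h)) *\<^sub>R F y = (LINT t|lborel. ?I t *\<^sub>R (?D t y *\<^sub>R F y))"
      by (simp add: has_bochner_integral_iff)
  qed
  \<comment> \<open>Only with the integral over \<open>y\<close> inside can the weak gradient be used for a fixed \<open>t\<close>.\<close>
  also have "\<dots> = (LINT t|lborel. (LINT y|lborel. ?I t *\<^sub>R (?D t y *\<^sub>R F y)))"
    using lborel_pair.Fubini_integral[OF p1] .
  also have "\<dots> = (LINT t|lborel. ?I t *\<^sub>R (- (LINT y|lborel. \<phi> (y - t *\<^sub>R h) *\<^sub>R directional W h y)))"
  proof (intro Bochner_Integration.integral_cong refl)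
    fix t :: real
    show "(LINT y|lborel. ?I t *\<^sub>R (?D t y *\<^sub>R F y))
        = ?I t *\<^sub>R (- (LINT y|lborel. \<phi> (y - t *\<^sub>R h) *\<^sub>R directional W h y))"
      using weak_directional_derivative[OF W \<phi>, of t h]
      by (cases "t \<in> {0..1}") (simp_all add: dtr)
  qed
  also have "\<dots> = - (LINT t|lborel. (LINT x|lborel. ?I t *\<^sub>R (\<phi> x *\<^sub>R directional W h (x + t *\<^sub>R h))))"
    by (simp add: shift del: scaleR_scaleR)
  also have "\<dots> = - (LINT x|lborel. (LINT t|lborel. ?I t *\<^sub>R (\<phi> x *\<^sub>R directional W h (x + t *\<^sub>R h))))"
    by (rule arg_cong[OF lborel_pair.Fubini_integral[OF p2, symmetric]])
  also have "\<dots> = - (LINT x|lborel. \<phi> x *\<^sub>R segment_integral W h x)"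
    by (simp only: pull)
  finally have "(LINT x|lborel. \<phi> x *\<^sub>R F x) - (LINT x|lborel. \<phi> x *\<^sub>R F (x + h))
      = - (LINT x|lborel. \<phi> x *\<^sub>R segment_integral W h x)" .
  then have eq: "(LINT x|lborel. \<phi> x *\<^sub>R F (x + h)) - (LINT x|lborel. \<phi> x *\<^sub>R F x)
      - (LINT x|lborel. \<phi> x *\<^sub>R segment_integral W h x) = 0"
    by (metis add.inverse_inverse diff_self minus_diff_eq)
  have "(LINT x|lborel. \<phi> x *\<^sub>R (F (x + h) - F x - segment_integral W h x))
      = (LINT x|lborel. \<phi> x *\<^sub>R F (x + h) - \<phi> x *\<^sub>R F x - \<phi> x *\<^sub>R segment_integral W h x)"
    by (simp only: scaleR_diff_right)
  also have "\<dots> = (LINT x|lborel. \<phi> x *\<^sub>R F (x + h)) - (LINT x|lborel. \<phi> x *\<^sub>R F x)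
      - (LINT x|lborel. \<phi> x *\<^sub>R segment_integral W h x)"
    by (simp only: Bochner_Integration.integral_diff Bochner_Integration.integrable_diff
        i\<phi>[OF F] i\<phi>[OF Fh] i\<phi>[OF segment_integral_integrable[OF W]])
  finally show ?thesis using eq by simp
qed


section \<open>Increments are almost everywhere integrals of the gradient\<close>

text \<open>
  Boxes form an intersection-stable generator of the Borel sets, so the vanishing of the integral
  spreads from boxes to all Borel sets. Since \<open>E\<close> itself need not be a box, this is done inside each
  member of a countable cover of \<open>E\<close> by closed boxes.
\<close>

lemma AE_eq_0_if_box_integrals_0:
  fixes D :: "'a::euclidean_space \<Rightarrow> complex"
  assumes D: "integrable lborel D" and E: "open E"
    and zero: "\<And>a b. cbox a b \<subseteq> E \<Longrightarrow> (LINT x|lborel. indicator (box a b) x *\<^sub>R D x) = 0"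
  shows "AE x in lborel. x \<in> E \<longrightarrow> D x = 0"
proof -
  have loc: "AE x in lborel. x \<in> cbox a b \<longrightarrow> D x = 0" if ab: "cbox a b \<subseteq> E" for a b
  proof -
    define g where "g x = indicator (box a b) x *\<^sub>R D x" for x
    have g: "integrable lborel g"
      unfolding g_def[abs_def] using D by (intro integrable_mult_indicator) auto
    have gi: "set_integrable lborel A g" if "A \<in> sets lborel" for A
      unfolding set_integrable_def using that g by (intro integrable_mult_indicator)
    have "AE x in lborel. g x = 0"
    proof (rule sigma_finite_measure.density_zero[OF sigma_finite_lborel g])
      fix A :: "'a set" assume "A \<in> sets lborel"
      then have A: "A \<in> sigma_sets UNIV (range (\<lambda>(a, b). box a b))"
        by (simp add: borel_eq_box)
      have sets: "A \<in> sets lborel" if "A \<in> sigma_sets UNIV (range (\<lambda>(a, b). box a b))" for A :: "'a set"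
        using that by (simp add: borel_eq_box)
      have "Int_stable (range (\<lambda>(a, b). box a b :: 'a set))"
        by (auto simp: Int_stable_def box_Int_box)
      moreover have "range (\<lambda>(a, b). box a b :: 'a set) \<subseteq> Pow UNIV" by simp
      ultimately show "set_lebesgue_integral lborel A g = 0"
        using A
      proof (induction rule: sigma_sets_induct_disjoint)
        case (basic A)
        then obtain c d where "A = box c d" by auto
        then obtain e f where ef: "A \<inter> box a b = box e f"
          by (auto simp: box_Int_box)
        have "(LINT x|lborel. indicator (box e f) x *\<^sub>R D x) = 0"
        \<comment> \<open>An empty open box may have a nonempty closed box \<open>cbox e f\<close> outside \<open>E\<close>.\<close>
        proof (cases "box e f = {}")
          case False
          then have "cbox e f = closure (box e f)" by (simp add: closure_box)
          also have "\<dots> \<subseteq> cbox a b"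
            using ef box_subset_cbox[of a b] by (intro closure_minimal) auto
          finally show ?thesis using ab by (intro zero) auto
        qed simp
        then show ?case
          unfolding set_lebesgue_integral_def g_def ef[symmetric] by (simp add: indicator_inter_arith)
      next
        case (compl A)
        have "set_lebesgue_integral lborel ((UNIV - A) \<union> A) g
            = set_lebesgue_integral lborel (UNIV - A) g + set_lebesgue_integral lborel A g"
          using sets[OF compl(1)] by (intro set_integral_Un gi) auto
        moreover have "set_lebesgue_integral lborel UNIV g = 0"
          using zero[OF ab] by (simp add: set_lebesgue_integral_def g_def)
        ultimately show ?case using compl by simp
      next
        case (union A)
        have "\<And>i. A i \<in> sets lborel" using union by (intro sets) auto
        then show ?case
          using union
          by (subst lebesgue_integral_countable_add) (auto simp: disjoint_family_on_def intro!: gi)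
      qed (auto simp: set_lebesgue_integral_def)
    qed
    moreover have "AE x in lborel. x \<notin> cbox a b - box a b"
      using negligible_frontier_interval[of a b]
      by (intro AE_not_in) (simp add: negligible_iff_null_sets null_sets_completion_iff)
    ultimately show ?thesis
      by eventually_elim (auto simp: g_def)
  qed
  obtain \<D> where \<D>: "countable \<D>" "\<D> \<subseteq> Pow E" "\<And>X. X \<in> \<D> \<Longrightarrow> \<exists>a b. X = cbox a b" "\<Union>\<D> = E"
    using open_countable_Union_open_cbox[OF E] by blast
  have "AE x in lborel. \<forall>X\<in>\<D>. x \<in> X \<longrightarrow> D x = 0"
  proof (subst AE_ball_countable[OF \<D>(1)], intro ballI)
    fix X assume "X \<in> \<D>"
    moreover from \<D>(3)[OF this] obtain a b where "X = cbox a b" by blast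
    ultimately show "AE x in lborel. x \<in> X \<longrightarrow> D x = 0" using loc \<D>(2) by auto
  qed
  then show ?thesis
    by eventually_elim (use \<D>(4) in auto)
qed

text \<open>
  Testing the distributional identity against bumps that increase to the indicator of a box turns it
  into an identity of integrals over boxes, hence into a pointwise one.
\<close>

lemma difference_eq_segment_integral:
  assumes W: "L1_weak_gradient U F W" and E: "open E"
    and seg: "\<And>x. x \<in> E \<Longrightarrow> closed_segment x (x + h) \<subseteq> U"
  shows "AE x in lborel. x \<in> E \<longrightarrow> F (x + h) - F x = segment_integral W h x"
proof -
  have F: "integrable lborel F" using W by (simp add: L1_weak_gradient_def)
  have [measurable]: "F \<in> borel_measurable borel"
    using borel_measurable_integrable[OF F] by simp
  define D where "D x = F (x + h) - F x - segment_integral W h x" for x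
  have D: "integrable lborel D"
    unfolding D_def[abs_def]
    by (intro Bochner_Integration.integrable_diff segment_integral_integrable[OF W] F)
       (simp add: integrable_lborel_translate F)
  then have [measurable]: "D \<in> borel_measurable borel"
    using borel_measurable_integrable by auto
  have "AE x in lborel. x \<in> E \<longrightarrow> D x = 0"
  proof (rule AE_eq_0_if_box_integrals_0[OF D E])
    fix a b assume ab: "cbox a b \<subseteq> E"
    have "(LINT x|lborel. box_bump n a b x *\<^sub>R D x) = 0" for n
      unfolding D_def
    proof (rule weak_difference_identity[OF W box_bump_test_function])
      fix t :: real and x :: 'a assume "t \<in> {0..1}" "x \<in> cbox a b"
      then have "x + t *\<^sub>R h \<in> closed_segment x (x + h)" "x \<in> E"
        using ab by (auto simp: closed_segment_def algebra_simps intro!: exI[of _ t])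
      with seg show "x + t *\<^sub>R h \<in> U" by blast
    qed
    moreover have "(\<lambda>n. LINT x|lborel. box_bump n a b x *\<^sub>R D x)
        \<longlonglongrightarrow> (LINT x|lborel. indicator (box a b) x *\<^sub>R D x)"
    proof (rule integral_dominated_convergence[where w = "\<lambda>x. norm (D x)"])
      have "box_bump n a b \<in> borel_measurable borel" for n
        using C_times_diff_box_bump[of 0 n a b] by (simp add: borel_measurable_continuous_onI)
      then show "(\<lambda>x. box_bump n a b x *\<^sub>R D x) \<in> borel_measurable lborel" for n
        by simp
      show "AE x in lborel. (\<lambda>n. box_bump n a b x *\<^sub>R D x) \<longlonglongrightarrow> indicator (box a b) x *\<^sub>R D x"
        by (intro always_eventually allI tendsto_scaleR box_bump_tendsto tendsto_const)
      show "AE x in lborel. norm (box_bump n a b x *\<^sub>R D x) \<le> norm (D x)" for n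
        using box_bump_bounds[of n a b] by (auto intro!: mult_left_le_one_le always_eventually)
    qed (use D in simp_all)
    ultimately show "(LINT x|lborel. indicator (box a b) x *\<^sub>R D x) = 0"
      by (simp add: LIMSEQ_const_iff)
  qed
  then show ?thesis by (simp add: D_def algebra_simps)
qed

section \<open>A Poincare estimate between mutually visible sets\<close>

definition energy :: "'a::euclidean_space set \<Rightarrow> ('a \<Rightarrow> 'a \<Rightarrow> complex) \<Rightarrow> ennreal" where
  "energy U W = (\<integral>\<^sup>+x. indicator U x * ennreal (\<Sum>b\<in>Basis. (norm (W b x))\<^sup>2) \<partial>lborel)"

lemma norm_directional_le:
  "(norm (directional W h x))\<^sup>2 \<le> (norm h)\<^sup>2 * (\<Sum>b\<in>Basis. (norm (W b x))\<^sup>2)"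
proof -
  have "norm (directional W h x) \<le> (\<Sum>b\<in>Basis. \<bar>h \<bullet> b\<bar> * norm (W b x))"
    unfolding directional_def by (rule order_trans[OF norm_sum]) simp
  then have "(norm (directional W h x))\<^sup>2 \<le> (\<Sum>b\<in>Basis. \<bar>h \<bullet> b\<bar> * norm (W b x))\<^sup>2"
    by (rule power_mono) simp
  also have "\<dots> \<le> (\<Sum>b\<in>Basis. \<bar>h \<bullet> b\<bar>\<^sup>2) * (\<Sum>b\<in>Basis. (norm (W b x))\<^sup>2)"
    by (rule Cauchy_Schwarz_ineq_sum)
  also have "(\<Sum>b\<in>Basis. \<bar>h \<bullet> b\<bar>\<^sup>2) = (norm h)\<^sup>2"
    unfolding power2_norm_eq_inner by (subst euclidean_inner) (simp add: power2_eq_square)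
  finally show ?thesis .
qed

lemma norm_segment_integral_le:
  assumes W: "L1_weak_gradient U F W"
  shows "ennreal ((norm (segment_integral W h x))\<^sup>2)
    \<le> (\<integral>\<^sup>+t. indicator {0..1} t * ennreal ((norm (directional W h (x + t *\<^sub>R h)))\<^sup>2) \<partial>lborel)"
proof -
  have [measurable]: "directional W h \<in> borel_measurable borel"
    using borel_measurable_integrable[OF directional_integrable[OF W]] by simp
  let ?d = "\<lambda>t. directional W h (x + t *\<^sub>R h)"
  have "ennreal (norm (segment_integral W h x)) \<le> (\<integral>\<^sup>+t. indicator {0..1} t * ennreal (norm (?d t)) \<partial>lborel)"
  proof (cases "integrable lborel (\<lambda>t. indicator {0..1::real} t *\<^sub>R ?d t)")
    case True
    have "ennreal (norm (segment_integral W h x)) \<le> (\<integral>\<^sup>+t. norm (indicator {0..1::real} t *\<^sub>R ?d t) \<partial>lborel)"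
      unfolding segment_integral_def using True by (rule integral_norm_bound_ennreal)
    also have "\<dots> = (\<integral>\<^sup>+t. indicator {0..1} t * ennreal (norm (?d t)) \<partial>lborel)"
      by (intro nn_integral_cong) (auto split: split_indicator)
    finally show ?thesis .
  qed (simp add: segment_integral_def not_integrable_integral_eq)
  then have "(ennreal (norm (segment_integral W h x)))\<^sup>2
      \<le> (\<integral>\<^sup>+t. indicator {0..1} t * ennreal (norm (?d t)) \<partial>lborel)\<^sup>2"
    by (rule power_mono) simp
  also have "\<dots> = (\<integral>\<^sup>+t. indicator {0..1} t * (indicator {0..1} t * ennreal (norm (?d t))) \<partial>lborel)\<^sup>2"
    by (intro arg_cong[where f = "\<lambda>x. x\<^sup>2"] nn_integral_cong) (auto split: split_indicator)
  also have "\<dots> \<le> (\<integral>\<^sup>+t. (indicator {0..1::real} t)\<^sup>2 \<partial>lborel) *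
      (\<integral>\<^sup>+t. (indicator {0..1} t * ennreal (norm (?d t)))\<^sup>2 \<partial>lborel)"
    by (rule Cauchy_Schwarz_nn_integral) measurable
  also have "(\<integral>\<^sup>+t. (indicator {0..1::real} t)\<^sup>2 \<partial>lborel) = (\<integral>\<^sup>+t. indicator {0..1::real} t \<partial>lborel)"
    by (intro nn_integral_cong) (auto split: split_indicator)
  also have "(\<integral>\<^sup>+t. (indicator {0..1} t * ennreal (norm (?d t)))\<^sup>2 \<partial>lborel)
     = (\<integral>\<^sup>+t. indicator {0..1} t * ennreal ((norm (?d t))\<^sup>2) \<partial>lborel)"
    by (intro nn_integral_cong) (auto split: split_indicator simp: ennreal_power)
  finally show ?thesis by (simp add: ennreal_power)
qed

text \<open>
  By Cauchy-Schwarz on the unit interval the squared increment is at most the average of the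
  squared directional derivative along the segment. Integrating over \<open>x\<close> first, each
  \<open>t\<close> contributes at most \<open>(norm h)\<^sup>2\<close> times the energy, because Lebesgue measure is translation
  invariant and the segments stay in \<open>U\<close>.
\<close>

lemma difference_L2_bound:
  assumes W: "L1_weak_gradient U F W" and U: "open U" and E: "open E"
    and seg: "\<And>x. x \<in> E \<Longrightarrow> closed_segment x (x + h) \<subseteq> U"
  shows "(\<integral>\<^sup>+x. indicator E x * ennreal ((norm (F (x + h) - F x))\<^sup>2) \<partial>lborel)
    \<le> ennreal ((norm h)\<^sup>2) * energy U W"
proof -
  have [measurable]: "W b \<in> borel_measurable borel" if "b \<in> Basis" for b
    using W that borel_measurable_integrable by (auto simp: L1_weak_gradient_def)
  have [measurable]: "U \<in> sets borel" using U by simp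
  define e where "e y = indicator U y * ennreal (\<Sum>b\<in>Basis. (norm (W b y))\<^sup>2)" for y
  have [measurable]: "e \<in> borel_measurable borel"
    unfolding e_def[abs_def] by measurable
  let ?I = "indicator {0..1::real} :: real \<Rightarrow> ennreal"
  let ?h = "ennreal ((norm h)\<^sup>2)"
  have ae: "AE x in lborel. x \<in> E \<longrightarrow> F (x + h) - F x = segment_integral W h x"
    using W E seg by (rule difference_eq_segment_integral)
  have "AE x in lborel. indicator E x * ennreal ((norm (F (x + h) - F x))\<^sup>2)
      \<le> (\<integral>\<^sup>+t. ?I t * (?h * e (x + t *\<^sub>R h)) \<partial>lborel)"
    using ae
  proof eventually_elim
    fix x assume x: "x \<in> E \<longrightarrow> F (x + h) - F x = segment_integral W h x"
    show "indicator E x * ennreal ((norm (F (x + h) - F x))\<^sup>2)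
      \<le> (\<integral>\<^sup>+t. ?I t * (?h * e (x + t *\<^sub>R h)) \<partial>lborel)"
    proof (cases "x \<in> E")
      case True
      have "indicator E x * ennreal ((norm (F (x + h) - F x))\<^sup>2)
          \<le> (\<integral>\<^sup>+t. ?I t * ennreal ((norm (directional W h (x + t *\<^sub>R h)))\<^sup>2) \<partial>lborel)"
        using x True norm_segment_integral_le[OF W] by simp
      also have "\<dots> \<le> (\<integral>\<^sup>+t. ?I t * (?h * e (x + t *\<^sub>R h)) \<partial>lborel)"
      proof (rule nn_integral_mono)
        fix t :: real
        show "?I t * ennreal ((norm (directional W h (x + t *\<^sub>R h)))\<^sup>2) \<le> ?I t * (?h * e (x + t *\<^sub>R h))"
        proof (cases "t \<in> {0..1}")
          case t: True
          have "x + t *\<^sub>R h \<in> closed_segment x (x + h)"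
            using t by (auto simp: closed_segment_def algebra_simps intro!: exI[of _ t])
          then have "x + t *\<^sub>R h \<in> U" using seg[OF True] by blast
          then show ?thesis
            using norm_directional_le[of W h "x + t *\<^sub>R h"]
            by (auto simp: e_def ennreal_mult'[symmetric] sum_nonneg intro!: mult_left_mono ennreal_leI)
        qed simp
      qed
      finally show ?thesis .
    qed simp
  qed
  then have "(\<integral>\<^sup>+x. indicator E x * ennreal ((norm (F (x + h) - F x))\<^sup>2) \<partial>lborel)
      \<le> (\<integral>\<^sup>+x. \<integral>\<^sup>+t. ?I t * (?h * e (x + t *\<^sub>R h)) \<partial>lborel \<partial>lborel)"
    by (rule nn_integral_mono_AE)
  also have "\<dots> = (\<integral>\<^sup>+t. \<integral>\<^sup>+x. ?I t * (?h * e (x + t *\<^sub>R h)) \<partial>lborel \<partial>lborel)"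
    by (rule lborel_pair.Fubini') measurable
  also have "\<dots> = (\<integral>\<^sup>+t. ?I t * (?h * energy U W) \<partial>lborel)"
    using nn_integral_lborel_translate[of e]
    by (simp add: nn_integral_cmult energy_def e_def[symmetric])
  also have "\<dots> = ?h * energy U W"
    by (simp add: nn_integral_multc)
  finally show ?thesis .
qed

text \<open>
  Substituting \<open>y = x + h\<close> and integrating over \<open>x\<close> for fixed \<open>h\<close> reduces the double integral to
  the estimate for a single increment. Only vectors \<open>h\<close> of norm at most \<open>R\<close> occur.
\<close>

lemma visible_pairs_bound:
  fixes S B :: "'a::euclidean_space set"
  assumes W: "L1_weak_gradient U F W" and U: "open U" and S: "open S" and B: "open B"
    and seg: "\<And>x y. x \<in> S \<Longrightarrow> y \<in> B \<Longrightarrow> closed_segment x y \<subseteq> U"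
    and R: "\<And>x y. x \<in> S \<Longrightarrow> y \<in> B \<Longrightarrow> norm (y - x) \<le> R"
  shows "(\<integral>\<^sup>+y. indicator B y * (\<integral>\<^sup>+x. indicator S x * ennreal ((norm (F x - F y))\<^sup>2) \<partial>lborel) \<partial>lborel)
    \<le> ennreal (R\<^sup>2) * emeasure lborel (cball (0::'a) R) * energy U W"
proof -
  have F: "integrable lborel F" using W by (simp add: L1_weak_gradient_def)
  have [measurable]: "F \<in> borel_measurable borel" "S \<in> sets borel" "B \<in> sets borel"
    using borel_measurable_integrable[OF F] S B by simp_all
  define k where "k x y = indicator S x * indicator B y * ennreal ((norm (F y - F x))\<^sup>2)" for x y
  have [measurable]: "(\<lambda>(x, y). k x y) \<in> borel_measurable (borel \<Otimes>\<^sub>M borel)"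
    unfolding k_def by measurable
  have "(\<integral>\<^sup>+y. indicator B y * (\<integral>\<^sup>+x. indicator S x * ennreal ((norm (F x - F y))\<^sup>2) \<partial>lborel) \<partial>lborel)
      = (\<integral>\<^sup>+y. \<integral>\<^sup>+x. k x y \<partial>lborel \<partial>lborel)"
    by (intro nn_integral_cong, subst nn_integral_cmult[symmetric])
       (auto simp: k_def norm_minus_commute mult_ac)
  also have "\<dots> = (\<integral>\<^sup>+x. \<integral>\<^sup>+y. k x y \<partial>lborel \<partial>lborel)"
    by (rule lborel_pair.Fubini'[symmetric]) measurable
  also have "\<dots> = (\<integral>\<^sup>+x. \<integral>\<^sup>+h. k x (x + h) \<partial>lborel \<partial>lborel)"
    using nn_integral_lborel_translate[of "k x" x for x]
    by (simp add: add.commute)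
  also have "\<dots> = (\<integral>\<^sup>+h. \<integral>\<^sup>+x. k x (x + h) \<partial>lborel \<partial>lborel)"
    by (rule lborel_pair.Fubini') measurable
  also have "\<dots> \<le> (\<integral>\<^sup>+h. (ennreal (R\<^sup>2) * energy U W) * indicator (cball (0::'a) R) h \<partial>lborel)"
  proof (rule nn_integral_mono)
    fix h :: 'a
    \<comment> \<open>The points of \<open>S\<close> that are moved into \<open>B\<close> by \<open>h\<close>.\<close>
    define E where "E = S \<inter> (\<lambda>x. x + h) -` B"
    have E: "open E"
      unfolding E_def by (intro open_Int S open_vimage[OF B] continuous_intros)
    have "(\<integral>\<^sup>+x. k x (x + h) \<partial>lborel) = (\<integral>\<^sup>+x. indicator E x * ennreal ((norm (F (x + h) - F x))\<^sup>2) \<partial>lborel)"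
      by (intro nn_integral_cong) (auto simp: k_def E_def split: split_indicator)
    also have "\<dots> \<le> (ennreal (R\<^sup>2) * energy U W) * indicator (cball 0 R) h"
    proof (cases "E = {}")
      case False
      then have h: "norm h \<le> R" using R by (fastforce simp: E_def)
      have "(\<integral>\<^sup>+x. indicator E x * ennreal ((norm (F (x + h) - F x))\<^sup>2) \<partial>lborel)
          \<le> ennreal ((norm h)\<^sup>2) * energy U W"
        by (rule difference_L2_bound[OF W U E]) (use seg in \<open>auto simp: E_def\<close>)
      also have "\<dots> \<le> ennreal (R\<^sup>2) * energy U W"
        using h by (intro mult_right_mono ennreal_leI power_mono) auto
      finally show ?thesis using h by simp
    qed simp
    finally show "(\<integral>\<^sup>+x. k x (x + h) \<partial>lborel) \<le> (ennreal (R\<^sup>2) * energy U W) * indicator (cball 0 R) h" .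
  qed
  also have "\<dots> = ennreal (R\<^sup>2) * emeasure lborel (cball (0::'a) R) * energy U W"
    by (subst nn_integral_cmult_indicator) (auto simp: mult_ac)
  finally show ?thesis .
qed

lemma exists_le_average:
  fixes \<Psi> :: "'a \<Rightarrow> ennreal"
  assumes [measurable]: "\<Psi> \<in> borel_measurable M" "B \<in> sets M"
    and B: "0 < emeasure M B" "emeasure M B < \<infinity>"
  shows "\<exists>y\<in>B. \<Psi> y \<le> (\<integral>\<^sup>+x. indicator B x * \<Psi> x \<partial>M) / emeasure M B"
proof (rule ccontr)
  let ?Q = "\<integral>\<^sup>+x. indicator B x * \<Psi> x \<partial>M" and ?\<beta> = "emeasure M B"
  assume "\<not> ?thesis"
  then have less: "?Q / ?\<beta> < \<Psi> y" if "y \<in> B" for y using that by (auto simp: not_le)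
  obtain y0 where "y0 \<in> B" using B by fastforce
  then have "?Q / ?\<beta> < \<infinity>"
    using less[of y0] by (metis top.not_eq_extremum order_less_le_trans top_greatest infinity_ennreal_def less_irrefl)
  then have fin: "?Q < \<infinity>"
    using B by (auto simp: ennreal_divide_eq_top_iff simp flip: less_top)
  have "(\<integral>\<^sup>+x. ?Q / ?\<beta> * indicator B x \<partial>M) = ?Q / ?\<beta> * ?\<beta>"
    by (rule nn_integral_cmult_indicator) simp
  also have "\<dots> = ?Q"
    using B by (simp add: ennreal_divide_times)
  finally have eq: "(\<integral>\<^sup>+x. ?Q / ?\<beta> * indicator B x \<partial>M) = ?Q" .
  have "(\<integral>\<^sup>+x. ?Q / ?\<beta> * indicator B x \<partial>M) < ?Q"
  proof (rule nn_integral_less)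
    show "AE x in M. ?Q / ?\<beta> * indicator B x \<le> indicator B x * \<Psi> x"
      using less by (auto simp: less_imp_le split: split_indicator)
    show "\<not> (AE x in M. indicator B x * \<Psi> x \<le> ?Q / ?\<beta> * indicator B x)"
    proof
      assume "AE x in M. indicator B x * \<Psi> x \<le> ?Q / ?\<beta> * indicator B x"
      then have "AE x in M. x \<notin> B"
        by eventually_elim (use less in \<open>fastforce simp: not_le[symmetric] split: split_indicator_asm\<close>)
      then have "?\<beta> = 0" using AE_iff_null_sets[of B M] by auto
      with B show False by simp
    qed
  qed (use eq fin in auto)
  with eq show False by simp
qed

text \<open>
  A Poincare inequality on \<open>S\<close> whose right-hand side is the energy on all of \<open>U\<close>: \<open>F\<close> is compared
  with some constant \<open>m\<close>, and \<open>C\<close> is uniform in \<open>F\<close>. Unlike the mean-value form, this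
  version passes to unions without computing the means of \<open>F\<close> on different sets.
\<close>

definition poincare_on :: "'a::euclidean_space set \<Rightarrow> 'a set \<Rightarrow> bool" where
  "poincare_on U S \<longleftrightarrow> (\<exists>C<\<infinity>. \<forall>F W. L1_weak_gradient U F W \<longrightarrow>
     (\<exists>m. (\<integral>\<^sup>+x. indicator S x * ennreal ((norm (F x - m))\<^sup>2) \<partial>lborel) \<le> C * energy U W))"

lemma open_emeasure_lborel:
  fixes B :: "'a::euclidean_space set"
  assumes "open B" "B \<noteq> {}" "bounded B"
  shows "0 < emeasure lborel B" "emeasure lborel B < \<infinity>"
proof -
  show "emeasure lborel B < \<infinity>"
    using emeasure_bounded_finite[OF assms(3)] by simp
  have "\<not> negligible B" using assms open_not_negligible by blast
  then have "B \<notin> null_sets lborel"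
    using assms(1) by (simp add: negligible_iff_null_sets null_sets_completion_iff)
  then show "0 < emeasure lborel B"
    using assms(1) by (auto simp: null_sets_def zero_less_iff_neq_zero)
qed

text \<open>
  The constant is a value \<open>F y\<close>: some \<open>y\<close> in \<open>B\<close> does at least as well as the average over \<open>B\<close>,
  and the average is controlled by the integral over visible pairs.
\<close>

lemma poincare_on_visible:
  fixes S B :: "'a::euclidean_space set"
  assumes U: "open U" and S: "open S" "bounded S" and B: "open B" "B \<noteq> {}" "bounded B"
    and seg: "\<And>x y. x \<in> S \<Longrightarrow> y \<in> B \<Longrightarrow> closed_segment x y \<subseteq> U"
  shows "poincare_on U S"
proof -
  obtain r s where rs: "\<And>x. x \<in> S \<Longrightarrow> norm x \<le> r" "\<And>y. y \<in> B \<Longrightarrow> norm y \<le> s"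
    using S(2) B(3) by (auto simp: bounded_iff)
  have R: "norm (y - x) \<le> r + s" if "x \<in> S" "y \<in> B" for x y
    using norm_triangle_ineq4[of y x] rs(1)[OF that(1)] rs(2)[OF that(2)] by linarith
  note \<beta> = open_emeasure_lborel[OF B]
  define K where "K = ennreal ((r + s)\<^sup>2) * emeasure lborel (cball (0::'a) (r + s))"
  have K: "K < \<infinity>"
    unfolding K_def using emeasure_bounded_finite[OF bounded_cball, of 0 "r + s"]
    by (auto simp: ennreal_mult_less_top)
  show ?thesis
    unfolding poincare_on_def
  proof (intro exI[of _ "K / emeasure lborel B"] conjI allI impI)
    show "K / emeasure lborel B < \<infinity>"
      using K \<beta> by (auto simp: less_top[symmetric] ennreal_divide_eq_top_iff)
    fix F W assume W: "L1_weak_gradient U F W"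
    have F: "integrable lborel F" using W by (simp add: L1_weak_gradient_def)
    have [measurable]: "F \<in> borel_measurable borel" "S \<in> sets borel" "B \<in> sets borel"
      using borel_measurable_integrable[OF F] S B by simp_all
    let ?\<Psi> = "\<lambda>y. \<integral>\<^sup>+x. indicator S x * ennreal ((norm (F x - F y))\<^sup>2) \<partial>lborel"
    have "?\<Psi> \<in> borel_measurable lborel" by measurable
    from exists_le_average[OF this _ \<beta>]
    obtain y where "?\<Psi> y \<le> (\<integral>\<^sup>+y. indicator B y * ?\<Psi> y \<partial>lborel) / emeasure lborel B"
      by auto
    also have "\<dots> \<le> K * energy U W / emeasure lborel B"
      unfolding K_def
      by (intro divide_right_mono_ennreal visible_pairs_bound[OF W U S(1) B(1) seg R])
    also have "\<dots> = K / emeasure lborel B * energy U W"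
      by (simp add: ennreal_divide_times mult.commute ennreal_times_divide)
    finally show "\<exists>m. (\<integral>\<^sup>+x. indicator S x * ennreal ((norm (F x - m))\<^sup>2) \<partial>lborel)
        \<le> K / emeasure lborel B * energy U W" by blast
  qed
qed

lemma norm_diff_sq_le:
  fixes a b c :: "'a::real_normed_vector"
  shows "(norm (a - b))\<^sup>2 \<le> 2 * (norm (a - c))\<^sup>2 + 2 * (norm (c - b))\<^sup>2"
proof -
  have "norm (a - b) \<le> norm (a - c) + norm (c - b)"
    using norm_triangle_ineq[of "a - c" "c - b"] by simp
  then have "(norm (a - b))\<^sup>2 \<le> (norm (a - c) + norm (c - b))\<^sup>2" by (rule power_mono) simp
  also have "\<dots> \<le> 2 * (norm (a - c))\<^sup>2 + 2 * (norm (c - b))\<^sup>2"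
    using sum_squares_bound[of "norm (a - c)" "norm (c - b)"] by (simp add: power2_sum)
  finally show ?thesis .
qed

text \<open>
  The constants \<open>m\<close> and \<open>m'\<close> that belong to \<open>S\<close> and \<open>T\<close> are both close to \<open>F y\<close> for a suitable \<open>y\<close>
  in the intersection, hence close to each other; so \<open>m\<close> serves \<open>T\<close> as well, with a larger \<open>C\<close>. The
  intersection is open and nonempty, and thus has positive measure.
\<close>

lemma poincare_on_Un:
  fixes S T :: "'a::euclidean_space set"
  assumes PS: "poincare_on U S" and PT: "poincare_on U T"
    and S: "open S" "bounded S" and T: "open T" "bounded T" and ST: "S \<inter> T \<noteq> {}"
  shows "poincare_on U (S \<union> T)"
proof -
  obtain C where C: "C < \<infinity>" "\<And>F W. L1_weak_gradient U F W \<Longrightarrow>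
     \<exists>m. (\<integral>\<^sup>+x. indicator S x * ennreal ((norm (F x - m))\<^sup>2) \<partial>lborel) \<le> C * energy U W"
    using PS unfolding poincare_on_def by auto
  obtain C' where C': "C' < \<infinity>" "\<And>F W. L1_weak_gradient U F W \<Longrightarrow>
     \<exists>m. (\<integral>\<^sup>+x. indicator T x * ennreal ((norm (F x - m))\<^sup>2) \<partial>lborel) \<le> C' * energy U W"
    using PT unfolding poincare_on_def by auto
  have ST': "open (S \<inter> T)" "bounded (S \<inter> T)" using S T by (auto intro: bounded_Int)
  note \<beta> = open_emeasure_lborel[OF ST'(1) ST ST'(2)]
  have fT: "emeasure lborel T < \<infinity>" using emeasure_bounded_finite[OF T(2)] by simp
  define C2 where "C2 = C + (2 * C' + 2 * (2 * ((C + C') / emeasure lborel (S \<inter> T))) * emeasure lborel T)"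
  show ?thesis
    unfolding poincare_on_def
  proof (intro exI[of _ C2] conjI allI impI)
    have "(C + C') / emeasure lborel (S \<inter> T) < \<infinity>"
      using C(1) C'(1) \<beta> by (auto simp: less_top[symmetric] ennreal_divide_eq_top_iff)
    then show "C2 < \<infinity>"
      unfolding C2_def using C(1) C'(1) fT by (auto simp: ennreal_mult_less_top)
    fix F W assume W: "L1_weak_gradient U F W"
    have F: "integrable lborel F" using W by (simp add: L1_weak_gradient_def)
    have [measurable]: "F \<in> borel_measurable borel" "S \<in> sets borel" "T \<in> sets borel"
      using borel_measurable_integrable[OF F] S T by simp_all
    let ?E = "energy U W"
    obtain m where m: "(\<integral>\<^sup>+x. indicator S x * ennreal ((norm (F x - m))\<^sup>2) \<partial>lborel) \<le> C * ?E"
      using C(2)[OF W] by blast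
    obtain m' where m': "(\<integral>\<^sup>+x. indicator T x * ennreal ((norm (F x - m'))\<^sup>2) \<partial>lborel) \<le> C' * ?E"
      using C'(2)[OF W] by blast
    define \<Psi> where "\<Psi> x = ennreal ((norm (F x - m))\<^sup>2) + ennreal ((norm (F x - m'))\<^sup>2)" for x
    have "\<Psi> \<in> borel_measurable lborel" unfolding \<Psi>_def[abs_def] by measurable
    from exists_le_average[OF this _ \<beta>]
    obtain y where y: "\<Psi> y \<le> (\<integral>\<^sup>+x. indicator (S \<inter> T) x * \<Psi> x \<partial>lborel) / emeasure lborel (S \<inter> T)"
      by auto
    have "(\<integral>\<^sup>+x. indicator (S \<inter> T) x * \<Psi> x \<partial>lborel)
        \<le> (\<integral>\<^sup>+x. indicator S x * ennreal ((norm (F x - m))\<^sup>2)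
            + indicator T x * ennreal ((norm (F x - m'))\<^sup>2) \<partial>lborel)"
      by (intro nn_integral_mono) (auto simp: \<Psi>_def split: split_indicator)
    also have "\<dots> = (\<integral>\<^sup>+x. indicator S x * ennreal ((norm (F x - m))\<^sup>2) \<partial>lborel)
        + (\<integral>\<^sup>+x. indicator T x * ennreal ((norm (F x - m'))\<^sup>2) \<partial>lborel)"
      by (rule nn_integral_add) measurable
    also have "\<dots> \<le> (C + C') * ?E"
      using add_mono[OF m m'] by (simp add: distrib_right)
    finally have "\<Psi> y \<le> (C + C') * ?E / emeasure lborel (S \<inter> T)"
      using y by (blast intro: order_trans divide_right_mono_ennreal)
    then have \<Psi>y: "\<Psi> y \<le> (C + C') / emeasure lborel (S \<inter> T) * ?E"
      by (simp add: ennreal_divide_times mult.commute ennreal_times_divide)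
    \<comment> \<open>Compare the two constants through the value of \<open>F\<close> at the common point \<open>y\<close>.\<close>
    have "ennreal ((norm (m' - m))\<^sup>2) \<le> ennreal (2 * ((norm (F y - m))\<^sup>2 + (norm (F y - m'))\<^sup>2))"
      using norm_diff_sq_le[of m' m "F y"] by (intro ennreal_leI) (simp add: norm_minus_commute)
    also have "\<dots> = 2 * \<Psi> y"
      by (simp add: \<Psi>_def ennreal_mult' ennreal_plus)
    also have "\<dots> \<le> 2 * ((C + C') / emeasure lborel (S \<inter> T) * ?E)"
      by (intro mult_left_mono \<Psi>y) simp
    finally have mm: "ennreal ((norm (m' - m))\<^sup>2) \<le> 2 * ((C + C') / emeasure lborel (S \<inter> T)) * ?E"
      by (simp add: mult.assoc)
    have sq: "ennreal ((norm (F x - m))\<^sup>2)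
        \<le> 2 * ennreal ((norm (F x - m'))\<^sup>2) + 2 * ennreal ((norm (m' - m))\<^sup>2)" for x
      using ennreal_leI[OF norm_diff_sq_le[of "F x" m m']]
      by (simp add: ennreal_mult' ennreal_plus)
    have "(\<integral>\<^sup>+x. indicator (S \<union> T) x * ennreal ((norm (F x - m))\<^sup>2) \<partial>lborel)
        \<le> (\<integral>\<^sup>+x. indicator S x * ennreal ((norm (F x - m))\<^sup>2)
          + (2 * (indicator T x * ennreal ((norm (F x - m'))\<^sup>2))
             + 2 * ennreal ((norm (m' - m))\<^sup>2) * indicator T x) \<partial>lborel)"
      using sq by (intro nn_integral_mono) (auto intro: add_increasing2 split: split_indicator)
    also have "\<dots> = (\<integral>\<^sup>+x. indicator S x * ennreal ((norm (F x - m))\<^sup>2) \<partial>lborel)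
        + (2 * (\<integral>\<^sup>+x. indicator T x * ennreal ((norm (F x - m'))\<^sup>2) \<partial>lborel)
           + 2 * ennreal ((norm (m' - m))\<^sup>2) * emeasure lborel T)"
      by (simp add: nn_integral_add nn_integral_cmult)
    also have "\<dots> \<le> C * ?E + (2 * (C' * ?E)
        + 2 * (2 * ((C + C') / emeasure lborel (S \<inter> T)) * ?E) * emeasure lborel T)"
      by (intro add_mono m mult_left_mono m' mult_right_mono mm) auto
    also have "\<dots> = C2 * ?E"
      unfolding C2_def by (simp add: algebra_simps)
    finally show "\<exists>m. (\<integral>\<^sup>+x. indicator (S \<union> T) x * ennreal ((norm (F x - m))\<^sup>2) \<partial>lborel) \<le> C2 * ?E"
      by blast
  qed
qed


section \<open>From Sobolev functions to Borel representatives\<close>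

lemma nn_integral_lebesgue_on:
  assumes "U \<in> sets borel"
  shows "(\<integral>\<^sup>+x. k x \<partial>lebesgue_on U) = (\<integral>\<^sup>+x. indicator U x * k x \<partial>lborel)"
  using assms by (subst nn_integral_restrict_space) (auto simp: nn_integral_completion mult.commute)

lemma finite_measure_lebesgue_on:
  assumes "U \<in> sets borel" "emeasure lborel U < \<infinity>"
  shows "finite_measure (lebesgue_on U)"
  using assms by (intro finite_measureI) (simp add: emeasure_restrict_space space_restrict_space)

lemma L2_on_integrable:
  assumes "U \<in> sets borel" "emeasure lborel U < \<infinity>" "L2_on U g"
  shows "integrable (lebesgue_on U) g"
proof (rule integrable_norm_cancel)
  show "integrable (lebesgue_on U) (\<lambda>x. norm (g x))"
    by (rule finite_measure.square_integrable_imp_integrable[OF finite_measure_lebesgue_on[OF assms(1,2)]])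
       (use assms(3) in \<open>auto simp: L2_on_def\<close>)
qed (use assms(3) in \<open>auto simp: L2_on_def\<close>)

text \<open>
  The function \<open>G\<close> is obtained from the extension of \<open>g\<close> by zero. The clause on \<open>\<phi>\<close> says that \<open>g\<close> on
  \<open>U\<close> and \<open>G\<close> on the whole space are the same distribution.
\<close>

definition borel_representative ::
  "'a::euclidean_space set \<Rightarrow> ('a \<Rightarrow> complex) \<Rightarrow> ('a \<Rightarrow> complex) \<Rightarrow> bool" where
  "borel_representative U g G \<longleftrightarrow> integrable lborel G \<and> (AE x in lebesgue_on U. G x = g x) \<and>
    (\<forall>\<phi>\<in>borel_measurable borel.
      (LINT x|lborel. \<phi> x *\<^sub>R G x) = (LINT x|lebesgue_on U. \<phi> x *\<^sub>R g x))"

lemma borel_representative_integral: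
  "borel_representative U g G \<Longrightarrow> \<phi> \<in> borel_measurable borel \<Longrightarrow>
    (LINT x|lborel. \<phi> x *\<^sub>R G x) = (LINT x|lebesgue_on U. \<phi> x *\<^sub>R g x)"
  by (simp add: borel_representative_def)

lemma L2_on_borel_representative:
  fixes g :: "'a::euclidean_space \<Rightarrow> complex"
  assumes U: "U \<in> sets borel" "emeasure lborel U < \<infinity>" and g: "L2_on U g"
  shows "\<exists>G. borel_representative U g G"
proof -
  let ?g = "\<lambda>x. indicator U x *\<^sub>R g x"
  have "integrable (lebesgue_on U) g" using L2_on_integrable[OF U g] .
  then have ig: "integrable lebesgue ?g"
    using U(1) by (subst (asm) integrable_restrict_space) auto
  have "(\<lambda>x. Re (?g x)) \<in> borel_measurable lebesgue" "(\<lambda>x. Im (?g x)) \<in> borel_measurable lebesgue"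
    by (intro measurable_compose[OF borel_measurable_integrable[OF ig]]
        borel_measurable_continuous_onI continuous_intros)+
  then obtain p q where [measurable]: "p \<in> borel_measurable lborel" "q \<in> borel_measurable lborel"
    and "AE x in lborel. Re (?g x) = p x" "AE x in lborel. Im (?g x) = q x"
    by (auto dest!: completion_ex_borel_measurable_real)
  then have "AE x in lborel. Complex (p x) (q x) = ?g x"
    by (auto simp: complex_eq_iff elim: eventually_elim2)
  then have ae: "AE x in lebesgue. Complex (p x) (q x) = ?g x"
    by (rule AE_completion)
  define G where "G x = Complex (p x) (q x)" for x
  have [measurable]: "G \<in> borel_measurable borel"
    unfolding G_def[abs_def] Complex_eq by simp
  have [measurable]: "G \<in> borel_measurable lebesgue"
    by (rule measurable_completion) simp
  have "borel_representative U g G"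
    unfolding borel_representative_def
  proof (intro conjI ballI)
    have "integrable lebesgue G"
      using ig by (rule integrable_cong_AE_imp) (use ae in \<open>auto simp: G_def\<close>)
    then show "integrable lborel G"
      by (simp add: integrable_completion)
    show "AE x in lebesgue_on U. G x = g x"
      using U(1) ae by (subst AE_restrict_space_iff) (auto simp: G_def elim!: eventually_mono)
    fix \<phi> :: "'a \<Rightarrow> real" assume [measurable]: "\<phi> \<in> borel_measurable borel"
    have [measurable]: "\<phi> \<in> borel_measurable lebesgue"
      by (rule measurable_completion) simp
    have "(LINT x|lborel. \<phi> x *\<^sub>R G x) = (LINT x|lebesgue. \<phi> x *\<^sub>R G x)"
      by (rule integral_completion[symmetric]) simp
    also have "\<dots> = (LINT x|lebesgue. indicator U x *\<^sub>R (\<phi> x *\<^sub>R g x))"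
    proof (rule integral_cong_AE)
      have "(\<lambda>x. \<phi> x *\<^sub>R ?g x) \<in> borel_measurable lebesgue"
        by (rule borel_measurable_scaleR[OF _ borel_measurable_integrable[OF ig]]) simp
      then show "(\<lambda>x. indicator U x *\<^sub>R (\<phi> x *\<^sub>R g x)) \<in> borel_measurable lebesgue"
        by (simp add: mult.commute)
      show "AE x in lebesgue. \<phi> x *\<^sub>R G x = indicator U x *\<^sub>R (\<phi> x *\<^sub>R g x)"
        using ae by (auto simp: G_def elim!: eventually_mono)
    qed simp
    also have "\<dots> = (LINT x|lebesgue_on U. \<phi> x *\<^sub>R g x)"
      using U(1) by (subst integral_restrict_space) auto
    finally show "(LINT x|lborel. \<phi> x *\<^sub>R G x) = (LINT x|lebesgue_on U. \<phi> x *\<^sub>R g x)" .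
  qed
  then show ?thesis by blast
qed

lemma L1_weak_gradient_of_weak_differential:
  fixes f :: "'a::euclidean_space \<Rightarrow> complex"
  assumes U: "U \<in> sets borel" "emeasure lborel U < \<infinity>" and f: "L2_on U f"
    and \<omega>: "has_weak_differential U f \<omega>" "L2_form_on U \<omega>"
  obtains F W where "L1_weak_gradient U F W" "AE x in lebesgue_on U. F x = f x"
    "energy U W = ennreal ((L2_form_norm U \<omega>)\<^sup>2)"
proof -
  obtain F where F: "borel_representative U f F"
    using L2_on_borel_representative[OF U f] by blast
  have "\<forall>b\<in>Basis. \<exists>G. borel_representative U (\<lambda>x. blinfun_apply (\<omega> x) b) G"
    using \<omega>(2) by (intro ballI L2_on_borel_representative[OF U]) (simp add: L2_form_on_def)
  from bchoice[OF this] obtain W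
    where W: "\<And>b. b \<in> Basis \<Longrightarrow> borel_representative U (\<lambda>x. blinfun_apply (\<omega> x) b) (W b)"
    by blast
  have 1: "L1_weak_gradient U F W"
    unfolding L1_weak_gradient_def
  proof (intro conjI ballI)
    fix b :: 'a and \<phi> assume b: "b \<in> Basis" and \<phi>: "\<phi> \<in> test_functions U"
    have m: "\<phi> \<in> borel_measurable borel" "(\<lambda>x. frechet_derivative \<phi> (at x) b) \<in> borel_measurable borel"
      using test_function_continuous[OF \<phi>] test_function_derivative_continuous[OF \<phi>]
      by (auto intro: borel_measurable_continuous_onI)
    have "(LINT x|lborel. frechet_derivative \<phi> (at x) b *\<^sub>R F x)
        = (LINT x|lebesgue_on U. frechet_derivative \<phi> (at x) b *\<^sub>R f x)"
      by (rule borel_representative_integral[OF F m(2)])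
    also have "\<dots> = - (LINT x|lebesgue_on U. \<phi> x *\<^sub>R blinfun_apply (\<omega> x) b)"
      using \<omega>(1) b \<phi> by (simp add: has_weak_differential_def)
    also have "\<dots> = - (LINT x|lborel. \<phi> x *\<^sub>R W b x)"
      by (simp only: borel_representative_integral[OF W[OF b] m(1)])
    finally show "(LINT x|lborel. frechet_derivative \<phi> (at x) b *\<^sub>R F x) = - (LINT x|lborel. \<phi> x *\<^sub>R W b x)" .
  qed (use F W in \<open>auto simp: borel_representative_def\<close>)
  have "energy U W = (\<integral>\<^sup>+x. ennreal (\<Sum>b\<in>Basis. (norm (W b x))\<^sup>2) \<partial>lebesgue_on U)"
    unfolding energy_def using U(1) by (simp add: nn_integral_lebesgue_on)
  also have "\<dots> = (\<integral>\<^sup>+x. ennreal (\<Sum>b\<in>Basis. (norm (blinfun_apply (\<omega> x) b))\<^sup>2) \<partial>lebesgue_on U)"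
  proof (rule nn_integral_cong_AE)
    have "AE x in lebesgue_on U. \<forall>b\<in>Basis. W b x = blinfun_apply (\<omega> x) b"
      using W by (intro AE_finite_allI) (auto simp: borel_representative_def)
    then show "AE x in lebesgue_on U. ennreal (\<Sum>b\<in>Basis. (norm (W b x))\<^sup>2)
        = ennreal (\<Sum>b\<in>Basis. (norm (blinfun_apply (\<omega> x) b))\<^sup>2)"
      by eventually_elim (simp cong: sum.cong)
  qed
  also have "\<dots> = ennreal (LINT x|lebesgue_on U. (\<Sum>b\<in>Basis. (norm (blinfun_apply (\<omega> x) b))\<^sup>2))"
    using \<omega>(2) by (intro nn_integral_eq_integral) (auto simp: L2_form_on_def L2_on_def sum_nonneg)
  also have "\<dots> = ennreal ((L2_form_norm U \<omega>)\<^sup>2)"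
    unfolding L2_form_norm_def by (simp add: sum_nonneg integral_nonneg)
  finally have 2: "energy U W = ennreal ((L2_form_norm U \<omega>)\<^sup>2)" .
  have "AE x in lebesgue_on U. F x = f x" using F by (simp add: borel_representative_def)
  with 1 show ?thesis using 2 by (rule that)
qed

text \<open>
  The cross term in the expansion of \<open>(norm (f x - m))\<^sup>2\<close> integrates to zero, so among all constants
  the mean value \<open>m = 0\<close> is the best one.
\<close>

lemma mean_zero_minimizes:
  fixes f :: "'a::euclidean_space \<Rightarrow> complex"
  assumes U: "U \<in> sets borel" "emeasure lborel U < \<infinity>" and f: "L2_on U f"
    and zero: "L2_inner U f (\<lambda>_. 1) = 0"
  shows "ennreal ((L2_norm U f)\<^sup>2) \<le> (\<integral>\<^sup>+x. ennreal ((norm (f x - m))\<^sup>2) \<partial>lebesgue_on U)"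
proof -
  have i1: "integrable (lebesgue_on U) f" by (rule L2_on_integrable[OF U f])
  have i2: "integrable (lebesgue_on U) (\<lambda>x. (norm (f x))\<^sup>2)" using f by (simp add: L2_on_def)
  have i3: "integrable (lebesgue_on U) (\<lambda>x. (norm m)\<^sup>2)"
    by (rule finite_measure.integrable_const[OF finite_measure_lebesgue_on[OF U]])
  have i4: "integrable (lebesgue_on U) (\<lambda>x. Re (f x * cnj m))" using i1 by simp
  have eq: "(norm (f x - m))\<^sup>2 = (norm (f x))\<^sup>2 + (norm m)\<^sup>2 - 2 * Re (f x * cnj m)" for x
    unfolding cmod_power2 by (simp add: power2_eq_square algebra_simps)
  have "(LINT x|lebesgue_on U. f x) = 0" using zero by (simp add: L2_inner_def)
  then have "(LINT x|lebesgue_on U. Re (f x * cnj m)) = 0"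
    using i1 by (subst integral_Re) auto
  then have "(LINT x|lebesgue_on U. (norm (f x - m))\<^sup>2)
      = (LINT x|lebesgue_on U. (norm (f x))\<^sup>2) + (LINT x|lebesgue_on U. (norm m)\<^sup>2)"
    unfolding eq using i2 i3 i4
    by (simp only: Bochner_Integration.integral_diff Bochner_Integration.integral_add
        Bochner_Integration.integrable_add integral_mult_right_zero Bochner_Integration.integrable_mult_right)
  moreover have "0 \<le> (LINT x|lebesgue_on U. (norm m)\<^sup>2)" by (rule Bochner_Integration.integral_nonneg) simp
  moreover have "(L2_norm U f)\<^sup>2 = (LINT x|lebesgue_on U. (norm (f x))\<^sup>2)"
    unfolding L2_norm_def by (simp add: integral_nonneg)
  ultimately have "(L2_norm U f)\<^sup>2 \<le> (LINT x|lebesgue_on U. (norm (f x - m))\<^sup>2)" by linarith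
  moreover have "integrable (lebesgue_on U) (\<lambda>x. (norm (f x - m))\<^sup>2)"
    unfolding eq by (intro Bochner_Integration.integrable_diff Bochner_Integration.integrable_add
        Bochner_Integration.integrable_mult_right i2 i3 i4)
  ultimately show ?thesis
    by (subst nn_integral_eq_integral) (auto intro: ennreal_leI)
qed

lemma poincare_inequality_if_poincare_on:
  fixes U :: "'a::euclidean_space set"
  assumes U: "U \<in> sets borel" "emeasure lborel U < \<infinity>" and P: "poincare_on U U"
  shows "\<exists>C>0. \<forall>f \<in> Sobolev_W1 U. L2_inner U f (\<lambda>_. 1) = 0 \<longrightarrow>
           (L2_norm U f)\<^sup>2 \<le> C * (L2_form_norm U (weak_differential U f))\<^sup>2"
proof -
  obtain C where C: "C < \<infinity>" "\<And>F W. L1_weak_gradient U F W \<Longrightarrow>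
     \<exists>m. (\<integral>\<^sup>+x. indicator U x * ennreal ((norm (F x - m))\<^sup>2) \<partial>lborel) \<le> C * energy U W"
    using P unfolding poincare_on_def by auto
  show ?thesis
  proof (intro exI[of _ "enn2real C + 1"] conjI ballI impI)
    fix f assume "f \<in> Sobolev_W1 U" and zero: "L2_inner U f (\<lambda>_. 1) = 0"
    then have f: "L2_on U f" and ex: "\<exists>\<omega>. has_weak_differential U f \<omega> \<and> L2_form_on U \<omega>"
      by (auto simp: Sobolev_W1_def)
    let ?N = "(L2_form_norm U (weak_differential U f))\<^sup>2"
    from someI_ex[OF ex] obtain F W where W: "L1_weak_gradient U F W"
      and F: "AE x in lebesgue_on U. F x = f x" and E: "energy U W = ennreal ?N"
      using L1_weak_gradient_of_weak_differential[OF U f] unfolding weak_differential_def by blast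
    obtain m where m: "(\<integral>\<^sup>+x. indicator U x * ennreal ((norm (F x - m))\<^sup>2) \<partial>lborel) \<le> C * energy U W"
      using C(2)[OF W] by blast
    have "ennreal ((L2_norm U f)\<^sup>2) \<le> (\<integral>\<^sup>+x. ennreal ((norm (f x - m))\<^sup>2) \<partial>lebesgue_on U)"
      by (rule mean_zero_minimizes[OF U f zero])
    also have "\<dots> = (\<integral>\<^sup>+x. ennreal ((norm (F x - m))\<^sup>2) \<partial>lebesgue_on U)"
      using F by (intro nn_integral_cong_AE) (auto elim: eventually_mono)
    also have "\<dots> \<le> C * energy U W"
      using m U(1) by (simp add: nn_integral_lebesgue_on)
    also have "\<dots> = ennreal (enn2real C * ?N)"
      using C(1) E by (simp add: ennreal_mult')
    finally have "(L2_norm U f)\<^sup>2 \<le> enn2real C * ?N"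
      by (simp add: ennreal_le_iff)
    also have "\<dots> \<le> (enn2real C + 1) * ?N" by (intro mult_right_mono) auto
    finally show "(L2_norm U f)\<^sup>2 \<le> (enn2real C + 1) * ?N" .
  qed (simp add: add_nonneg_pos)
qed

section \<open>The geometry of the Hartogs triangle\<close>

lemma open_hartogs_triangle: "open hartogs_triangle"
  unfolding hartogs_triangle_def case_prod_beta
  by (intro open_Collect_conj open_Collect_less continuous_intros)

lemma norm_pair_le: "norm (z, w) \<le> norm z + norm w"
  using norm_triangle_ineq[of "(z, 0)" "(0, w)"] by simp

lemma bounded_hartogs_triangle: "bounded hartogs_triangle"
proof (rule boundedI)
  fix x assume "x \<in> hartogs_triangle"
  then show "norm x \<le> 2"
    using norm_pair_le[of "fst x" "snd x"] by (auto simp: hartogs_triangle_def)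
qed

text \<open>
  For \<open>e\<close> of modulus one these are the points whose coordinate \<open>w\<close> makes an angle with cosine above
  \<open>1 / 4\<close> with the direction \<open>e\<close>. The threshold lies below \<open>1 / sqrt 2\<close>, which makes the sectors of
  four orthogonal directions overlap and cover, and it leaves room for a fixed ball that is visible
  from the whole sector.
\<close>

definition hartogs_sector :: "complex \<Rightarrow> (complex \<times> complex) set" where
  "hartogs_sector e = {(z, w). (z, w) \<in> hartogs_triangle \<and> norm w < 4 * Re (w * cnj e)}"

lemma open_hartogs_sector: "open (hartogs_sector e)"
proof -
  have "hartogs_sector e = hartogs_triangle \<inter> {x. norm (snd x) < 4 * Re (snd x * cnj e)}"
    by (auto simp: hartogs_sector_def)
  also have "open \<dots>"
    by (intro open_Int open_hartogs_triangle open_Collect_less continuous_intros)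
  finally show ?thesis .
qed

lemma bounded_hartogs_sector: "bounded (hartogs_sector e)"
  by (rule bounded_subset[OF bounded_hartogs_triangle]) (auto simp: hartogs_sector_def)

text \<open>
  Towards a point with \<open>z' = 0\<close> and \<open>w' = e / 2\<close> the component of the second coordinate along
  \<open>w\<close> stays at least \<open>(1 - t) * norm w + t / 8\<close>, whereas the modulus of the first coordinate shrinks
  like \<open>(1 - t) * norm z\<close>. So the defining inequality survives along the segment, with a slack of
  \<open>t / 8\<close>; half of it absorbs the perturbation of \<open>w'\<close>, and the other half that of \<open>z'\<close>.
\<close>

lemma sector_sees_ball:
  assumes e: "norm e = 1" and x: "x \<in> hartogs_sector e" and y: "y \<in> ball (0, e / 2) (1 / 16)"
  shows "closed_segment x y \<subseteq> hartogs_triangle"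
proof
  fix p assume "p \<in> closed_segment x y"
  then obtain t where t: "0 \<le> t" "t \<le> 1" and p: "p = (1 - t) *\<^sub>R x + t *\<^sub>R y"
    by (auto simp: closed_segment_def)
  obtain z w where x_eq: "x = (z, w)" by (cases x)
  obtain z' w' where y_eq: "y = (z', w')" by (cases y)
  have zw: "norm z < norm w" "norm w < 1" "norm w < 4 * Re (w * cnj e)"
    using x by (auto simp: x_eq hartogs_sector_def hartogs_triangle_def)
  have "dist 0 z' < 1 / 16" "dist (e / 2) w' < 1 / 16"
    using y dist_fst_le[of "(0, e / 2)" y] dist_snd_le[of "(0, e / 2)" y] by (auto simp: y_eq)
  then have z': "norm z' < 1 / 16" and d: "norm (w' - e / 2) < 1 / 16"
    by (auto simp: dist_norm norm_minus_commute)
  have w': "norm w' < 1"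
    using norm_triangle_ineq[of "w' - e / 2" "e / 2"] d e by (simp add: norm_divide)
  have w0: "norm w > 0" using zw(1) norm_ge_zero[of z] by linarith
  let ?u = "(1 - t) *\<^sub>R w + t *\<^sub>R w'"
  have "Re (cnj w * w') = Re (w * cnj e) / 2 + Re (cnj w * (w' - e / 2))"
    by (simp add: algebra_simps)
  moreover have "\<bar>Re (cnj w * (w' - e / 2))\<bar> \<le> norm w * norm (w' - e / 2)"
    using abs_Re_le_cmod[of "cnj w * (w' - e / 2)"] by (simp add: norm_mult)
  moreover have "norm w * norm (w' - e / 2) \<le> norm w * (1 / 16)"
    using d by (intro mult_left_mono) auto
  ultimately have r: "norm w * (1 / 16) \<le> Re (cnj w * w')"
    using zw(3) by linarith
  have "norm w * ((1 - t) * norm w + t * (1 / 16))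
      = (1 - t) * (norm w)\<^sup>2 + t * (norm w * (1 / 16))"
    by (simp add: algebra_simps power2_eq_square)
  also have "\<dots> \<le> (1 - t) * (norm w)\<^sup>2 + t * Re (cnj w * w')"
    using t r by (intro add_left_mono mult_left_mono) auto
  also have "\<dots> = Re (cnj w * ?u)"
    unfolding cmod_power2 by (simp add: algebra_simps power2_eq_square)
  also have "\<dots> \<le> norm w * norm ?u"
    using complex_Re_le_cmod[of "cnj w * ?u"] by (simp add: norm_mult)
  finally have low: "(1 - t) * norm w + t * (1 / 16) \<le> norm ?u"
    using w0 by simp
  have "norm ((1 - t) *\<^sub>R z + t *\<^sub>R z') \<le> (1 - t) * norm z + t * norm z'"
    using norm_triangle_ineq[of "(1 - t) *\<^sub>R z" "t *\<^sub>R z'"] t by simp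
  also have "\<dots> < (1 - t) * norm w + t * (1 / 16)"
  proof (cases "t = 1")
    case False
    then show ?thesis
      using t zw(1) z' by (intro add_less_le_mono mult_strict_left_mono mult_left_mono) auto
  qed (use z' in simp)
  finally have "norm ((1 - t) *\<^sub>R z + t *\<^sub>R z') < norm ?u" using low by linarith
  moreover have "norm ?u < 1"
    using convexD[OF convex_ball[of 0 1], of w w' "1 - t" t] zw(2) w' t by simp
  ultimately show "p \<in> hartogs_triangle"
    by (simp add: p x_eq y_eq hartogs_triangle_def)
qed

lemma poincare_on_hartogs_sector:
  assumes "norm e = 1"
  shows "poincare_on hartogs_triangle (hartogs_sector e)"
  by (rule poincare_on_visible[where B = "ball (0, e / 2) (1 / 16)"])
     (use sector_sees_ball[OF assms] in
      \<open>auto simp: open_hartogs_triangle open_hartogs_sector bounded_hartogs_sector\<close>)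

text \<open>
  One of the four numbers \<open>Re w\<close>, \<open>Im w\<close>, \<open>- Re w\<close>, \<open>- Im w\<close> is at least half of \<open>norm w\<close>.
\<close>

lemma hartogs_triangle_eq_sectors:
  "hartogs_triangle = ((hartogs_sector 1 \<union> hartogs_sector \<i>) \<union> hartogs_sector (-1)) \<union> hartogs_sector (- \<i>)"
proof (rule set_eqI)
  fix x :: "complex \<times> complex"
  obtain z w where x: "x = (z, w)" by (cases x)
  have "norm w < 4 * Re w \<or> norm w < 4 * Im w \<or> norm w < - (4 * Re w) \<or> norm w < - (4 * Im w)"
    if "norm z < norm w"
    using cmod_le[of w] that norm_ge_zero[of z] by linarith
  then show "x \<in> hartogs_triangle \<longleftrightarrow> x \<in> ((hartogs_sector 1 \<union> hartogs_sector \<i>) \<union> hartogs_sector (-1)) \<union> hartogs_sector (- \<i>)"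
    unfolding x Un_iff hartogs_sector_def hartogs_triangle_def by simp blast
qed

lemma hartogs_sectors_meet:
  "(0, Complex (1/2) (1/2)) \<in> hartogs_sector 1 \<inter> hartogs_sector \<i>"
  "(0, Complex (-1/2) (1/2)) \<in> hartogs_sector \<i> \<inter> hartogs_sector (-1)"
  "(0, Complex (1/2) (-1/2)) \<in> hartogs_sector 1 \<inter> hartogs_sector (- \<i>)"
  by (auto simp: hartogs_sector_def hartogs_triangle_def cmod_def power2_eq_square
      intro!: real_less_lsqrt)

text \<open>
  Consecutive sectors around the circle are glued along their overlaps.
\<close>

lemma poincare_on_hartogs_triangle: "poincare_on hartogs_triangle hartogs_triangle"
proof -
  note P = poincare_on_hartogs_sector and O = open_hartogs_sector and B = bounded_hartogs_sector
  have "poincare_on hartogs_triangle (hartogs_sector 1 \<union> hartogs_sector \<i>)"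
    by (rule poincare_on_Un[OF P P O B O B]) (use hartogs_sectors_meet(1) in auto)
  then have "poincare_on hartogs_triangle (hartogs_sector 1 \<union> hartogs_sector \<i> \<union> hartogs_sector (-1))"
    by (rule poincare_on_Un[OF _ P _ _ O B])
       (use hartogs_sectors_meet(2) in \<open>auto simp: O B open_Un\<close>)
  then have "poincare_on hartogs_triangle
      (hartogs_sector 1 \<union> hartogs_sector \<i> \<union> hartogs_sector (-1) \<union> hartogs_sector (- \<i>))"
    by (rule poincare_on_Un[OF _ P _ _ O B])
       (use hartogs_sectors_meet(3) in \<open>auto simp: O B open_Un\<close>)
  then show ?thesis by (simp only: hartogs_triangle_eq_sectors[symmetric])
qed

theorem corollary2p16:
  shows "\<exists>C>0. \<forall>f \<in> Sobolev_W1 hartogs_triangle.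
           L2_inner hartogs_triangle f (\<lambda>_. 1) = 0 \<longrightarrow>
           (L2_norm hartogs_triangle f)\<^sup>2 \<le>
             C * (L2_form_norm hartogs_triangle (weak_differential hartogs_triangle f))\<^sup>2"
  by (rule poincare_inequality_if_poincare_on[OF _ _ poincare_on_hartogs_triangle])
     (simp_all add: open_hartogs_triangle emeasure_bounded_finite[OF bounded_hartogs_triangle, simplified])

end
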